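(* Let $n\ge 4$. The group $$G=\{(x,y,z)\mapsto(\lambda^2x,\pm\lambda^{n-2}y,\pm\lambda^{n-1}z)\mid\lambda\in\mathbb{C}^*\}\cong\mathbb{C}^*\times\mathbb{Z}/2\mathbb{Z}$$ acts on the Klein surface $S_{d_n}=\{(x,y,z)\in\mathbb{C}^3\mid x^{n-1}+xy^2+z^2=0\}$. If $n\ge 5$, then $\mathrm{Aut}(S_{d_n})=G$. If $n=4$, then $\mathrm{Aut}(S_{d_n})=G\rtimes\langle\tau\rangle$, where $\tau$ is the automorphism of order $3$ given by $$\tau\colon(x,y,z)\mapsto\left(-\tfrac12x+\tfrac{\mathbf{i}}{2}y,\ \tfrac32\mathbf{i}x-\tfrac12y,\ z\right).$$
   Context: $\mathrm{Aut}(S_{d_n})$ is the group of automorphisms of $S_{d_n}$ as a complex affine algebraic surface; linear automorphisms of $\mathbb{C}^3$ preserving $S_{d_n}$ are identified with their restrictions to $S_{d_n}$. The two signs $\pm$ in the definition of $G$ are chosen independently. $\mathbf{i}\in\mathbb{C}$ satisfies $\mathbf{i}^2=-1$.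
   Formalization: For n=4 the semidirect product is proved with ⟨τ⟩ as the normal factor and G as the complement; G itself is not normal, since conjugating (x,y,z)↦(x,−y,z) by τ gives a non-diagonal map. *)

theory Defs
  imports Complex_Main "HOL-Algebra.Algebra" "HOL-Computational_Algebra.Polynomial"
begin

type_synonym point3 = "complex \<times> complex \<times> complex"

section \<open>Regular maps and automorphism groups of affine varieties in three-space\<close>

inductive polynomial_fun3 :: "(point3 \<Rightarrow> complex) \<Rightarrow> bool" where
  const: "polynomial_fun3 (\<lambda>_. c)"
| coord_x: "polynomial_fun3 (\<lambda>(x, y, z). x)"
| coord_y: "polynomial_fun3 (\<lambda>(x, y, z). y)"
| coord_z: "polynomial_fun3 (\<lambda>(x, y, z). z)"
| add: "polynomial_fun3 f \<Longrightarrow> polynomial_fun3 g \<Longrightarrow> polynomial_fun3 (\<lambda>v. f v + g v)"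
| mult: "polynomial_fun3 f \<Longrightarrow> polynomial_fun3 g \<Longrightarrow> polynomial_fun3 (\<lambda>v. f v * g v)"

text \<open>On a closed subvariety of affine three-space the regular functions are exactly the
  restrictions of polynomials.\<close>

definition regular_map3 :: "point3 set \<Rightarrow> (point3 \<Rightarrow> point3) \<Rightarrow> bool" where
  "regular_map3 S f \<longleftrightarrow>
     (\<exists>p q r. polynomial_fun3 p \<and> polynomial_fun3 q \<and> polynomial_fun3 r \<and>
              (\<forall>v\<in>S. f v = (p v, q v, r v)))"

definition variety_Aut :: "point3 set \<Rightarrow> (point3 \<Rightarrow> point3) set" where
  "variety_Aut S =
     {f \<in> carrier (BijGroup S). regular_map3 S f \<and> regular_map3 S (inv\<^bsub>BijGroup S\<^esub> f)}"

definition variety_Aut_group :: "point3 set \<Rightarrow> (point3 \<Rightarrow> point3) monoid" where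
  "variety_Aut_group S = (BijGroup S) \<lparr>carrier := variety_Aut S\<rparr>"

lemma polynomial_fun3_compose:
  assumes "polynomial_fun3 f" "polynomial_fun3 p" "polynomial_fun3 q" "polynomial_fun3 r"
  shows "polynomial_fun3 (\<lambda>v. f (p v, q v, r v))"
  using assms(1)
  by induction (use assms(2-) in \<open>auto intro: polynomial_fun3.intros\<close>)

lemma polynomial_fun3_iff_poly:
  "polynomial_fun3 f \<longleftrightarrow>
     (\<exists>P :: complex poly poly poly. \<forall>x y z. f (x, y, z) = poly (poly (poly P [:[:z:]:]) [:y:]) x)"
  (is "_ \<longleftrightarrow> (\<exists>P. ?rep P f)")
proof
  assume "polynomial_fun3 f"
  then show "\<exists>P. ?rep P f"
  proof induction
    case (const c)
    show ?case by (rule exI[of _ "[:[:[:c:]:]:]"]) simp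
  next
    case coord_x
    show ?case by (rule exI[of _ "[:[:[:0, 1:]:]:]"]) simp
  next
    case coord_y
    show ?case by (rule exI[of _ "[:[:0, 1:]:]"]) simp
  next
    case coord_z
    show ?case by (rule exI[of _ "[:0, 1:]"]) simp
  next
    case (add f g)
    then obtain P Q where "?rep P f" "?rep Q g" by blast
    then show ?case by (intro exI[of _ "P + Q"]) simp
  next
    case (mult f g)
    then obtain P Q where "?rep P f" "?rep Q g" by blast
    then show ?case by (intro exI[of _ "P * Q"]) simp
  qed
next
  have x: "polynomial_fun3 (\<lambda>v. poly p (fst v))" for p
  proof (induction p)
    case 0
    show ?case using const[of 0] by simp
  next
    case (pCons a p)
    then show ?case
      using add[OF const[of a] mult[OF coord_x pCons.IH]] by (simp add: case_prod_beta)
  qed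
  have y: "polynomial_fun3 (\<lambda>v. poly (poly p [:fst (snd v):]) (fst v))" for p
  proof (induction p)
    case 0
    show ?case using const[of 0] by simp
  next
    case (pCons a p)
    then show ?case
      using add[OF x[of a] mult[OF coord_y pCons.IH]] by (simp add: case_prod_beta)
  qed
  have z: "polynomial_fun3 (\<lambda>v. poly (poly (poly p [:[:snd (snd v):]:]) [:fst (snd v):]) (fst v))" for p
  proof (induction p)
    case 0
    show ?case using const[of 0] by simp
  next
    case (pCons a p)
    then show ?case
      using add[OF y[of a] mult[OF coord_z pCons.IH]] by (simp add: case_prod_beta)
  qed
  assume "\<exists>P. ?rep P f"
  then obtain P where "?rep P f" by blast
  then have "f = (\<lambda>v. poly (poly (poly P [:[:snd (snd v):]:]) [:fst (snd v):]) (fst v))"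
    by auto
  then show "polynomial_fun3 f" using z by simp
qed

lemma regular_map3_id: "regular_map3 S (\<lambda>v\<in>S. v)"
  unfolding regular_map3_def using coord_x coord_y coord_z by fastforce

lemma regular_map3_compose:
  assumes "regular_map3 S f" "regular_map3 S g" "g \<in> S \<rightarrow> S"
  shows "regular_map3 S (compose S f g)"
proof -
  obtain p q r where f: "polynomial_fun3 p" "polynomial_fun3 q" "polynomial_fun3 r"
      "\<forall>v\<in>S. f v = (p v, q v, r v)"
    using assms(1) unfolding regular_map3_def by blast
  obtain p' q' r' where g: "polynomial_fun3 p'" "polynomial_fun3 q'" "polynomial_fun3 r'"
      "\<forall>v\<in>S. g v = (p' v, q' v, r' v)"
    using assms(2) unfolding regular_map3_def by blast
  have "polynomial_fun3 (\<lambda>v. h (p' v, q' v, r' v))" if "polynomial_fun3 h" for h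
    using polynomial_fun3_compose[OF that g(1-3)] .
  moreover have "compose S f g v =
      (p (p' v, q' v, r' v), q (p' v, q' v, r' v), r (p' v, q' v, r' v))" if "v \<in> S" for v
    using that f(4) g(4) assms(3) by (auto simp: compose_def dest!: funcset_mem)
  ultimately show ?thesis
    unfolding regular_map3_def using f(1-3) by blast
qed

lemma subgroup_variety_Aut: "subgroup (variety_Aut S) (BijGroup S)"
proof -
  interpret B: group "BijGroup S" by (rule group_BijGroup)
  have mult: "regular_map3 S (f \<otimes>\<^bsub>BijGroup S\<^esub> g)"
    if "f \<in> carrier (BijGroup S)" "g \<in> carrier (BijGroup S)" "regular_map3 S f" "regular_map3 S g" for f g
    using that regular_map3_compose[of S f g] Bij_imp_funcset[of g S] by (simp add: BijGroup_def)
  have one: "regular_map3 S \<one>\<^bsub>BijGroup S\<^esub>"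
    using regular_map3_id by (simp add: BijGroup_def)
  show ?thesis
  proof (rule subgroup.intro)
    show "variety_Aut S \<subseteq> carrier (BijGroup S)" by (auto simp: variety_Aut_def)
    show "\<one>\<^bsub>BijGroup S\<^esub> \<in> variety_Aut S" using one by (simp add: variety_Aut_def)
  next
    fix f g assume "f \<in> variety_Aut S" "g \<in> variety_Aut S"
    then show "f \<otimes>\<^bsub>BijGroup S\<^esub> g \<in> variety_Aut S"
      by (simp add: variety_Aut_def mult B.inv_mult_group)
  next
    fix f assume "f \<in> variety_Aut S"
    then show "inv\<^bsub>BijGroup S\<^esub> f \<in> variety_Aut S" by (simp add: variety_Aut_def)
  qed
qed

lemma group_variety_Aut_group: "group (variety_Aut_group S)"
  unfolding variety_Aut_group_def
  by (rule subgroup.subgroup_is_group[OF subgroup_variety_Aut group_BijGroup])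

section \<open>Group-theoretic notions\<close>

definition complex_mult_group :: "complex monoid" where
  "complex_mult_group = \<lparr>carrier = UNIV - {0}, monoid.mult = (*), one = 1\<rparr>"

text \<open>\<open>K\<close> is the internal semidirect product of the normal factor \<open>N\<close> and a complement \<open>H\<close>.\<close>

definition internal_semidirect ::
    "('a, 'b) monoid_scheme \<Rightarrow> 'a set \<Rightarrow> 'a set \<Rightarrow> bool" where
  "internal_semidirect K N H \<longleftrightarrow>
     N \<lhd> K \<and> subgroup H K \<and> N \<inter> H = {\<one>\<^bsub>K\<^esub>} \<and> N <#>\<^bsub>K\<^esub> H = carrier K"

section \<open>The surface and the explicit automorphisms\<close>

definition klein_surface_D :: "nat \<Rightarrow> point3 set" where
  "klein_surface_D n = {(x, y, z). x ^ (n - 1) + x * y\<^sup>2 + z\<^sup>2 = 0}"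

definition diag_map :: "nat \<Rightarrow> complex \<Rightarrow> complex \<Rightarrow> complex \<Rightarrow> point3 \<Rightarrow> point3" where
  "diag_map n l s t = (\<lambda>(x, y, z). (l\<^sup>2 * x, s * l ^ (n - 2) * y, t * l ^ (n - 1) * z))"

text \<open>The signs \<open>s\<close> and \<open>t\<close> are independent.\<close>

definition klein_G :: "nat \<Rightarrow> (point3 \<Rightarrow> point3) set" where
  "klein_G n = {diag_map n l s t | l s t. l \<noteq> 0 \<and> s \<in> {1, -1} \<and> t \<in> {1, -1}}"

definition klein_G_group :: "nat \<Rightarrow> (point3 \<Rightarrow> point3) monoid" where
  "klein_G_group n = (BijGroup UNIV) \<lparr>carrier := klein_G n\<rparr>"

text \<open>Linear maps of three-space are identified with their restrictions to the surface.\<close>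

definition klein_G_on :: "nat \<Rightarrow> (point3 \<Rightarrow> point3) set" where
  "klein_G_on n = (\<lambda>g. restrict g (klein_surface_D n)) ` klein_G n"

definition tau :: "point3 \<Rightarrow> point3" where
  "tau = (\<lambda>(x, y, z). (- (1 / 2) * x + \<i> / 2 * y, 3 / 2 * \<i> * x - 1 / 2 * y, z))"

text \<open>For \<open>n = 4\<close> the factor that is normal in the automorphism group is the one generated by
  \<open>tau\<close>, not \<open>klein_G_on 4\<close>: conjugating \<open>(x, y, z) \<mapsto> (x, -y, z)\<close> by \<open>tau\<close> gives a map that is
  not diagonal. The product written \<open>G \<rtimes> \<langle>\<tau>\<rangle>\<close> therefore has \<open>\<langle>\<tau>\<rangle>\<close> in the role of \<open>N\<close> in
  \<^const>\<open>internal_semidirect\<close>.\<close>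

definition tau_on :: "point3 \<Rightarrow> point3" where
  "tau_on = restrict tau (klein_surface_D 4)"

end

theory Submission
  imports Defs "HOL-Computational_Algebra.Polynomial_Factorial" "HOL-Computational_Algebra.Field_as_Ring"
    "HOL-Computational_Algebra.Nth_Powers" "HOL-Computational_Algebra.Fundamental_Theorem_Algebra"
begin

text \<open>The surface is the quotient of the plane by the binary dihedral group of order \<open>4 (n - 2)\<close>. An
  automorphism lifts to a polynomial map of the plane: its components \<open>X, Y, Z \<in> \<complex>[u, v]\<close> satisfy
  \<open>X (X\<^sup>n\<^sup>-\<^sup>2 + Y\<^sup>2) = - Z\<^sup>2\<close>, and no irreducible polynomial divides all three because the quotient map
  has finite fibres, so unique factorization gives \<open>X = W\<^sup>2\<close>, \<open>Z = W Q\<close>, and then the coprime factors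
  of \<open>Q\<^sup>2 + Y\<^sup>2 = - W\<^sup>2\<^sup>n\<^sup>-\<^sup>4\<close> are powers. Lifts are unique up to the deck group, hence invertible and
  equivariant. If the components of a lift had degree \<open>d > 1\<close>, their constant Jacobian would force
  their leading forms to be proportional, which contradicts the irreducibility of the plane as a
  representation of the deck group. So lifts are linear, and they normalize the deck group; this
  leaves the diagonal maps and, for \<open>n = 4\<close>, their products with powers of \<open>\<tau>\<close>.\<close>

section \<open>Polynomials in two variables\<close>

text \<open>Lifting is usually topological: the plane minus the origin is simply connected and
  covers the smooth part of the surface. Factorization replaces this and yields polynomial lifts at
  once. Its only geometric input is that an automorphism cannot contract the image of a plane curve
  to a point, because its inverse would then make the quotient map constant on that curve. Total
  degree is awkward for nested one-variable polynomials. The blow-up chart (s t, t) turns it into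
  the degree in t, at the price that the Jacobian of a deck transformation becomes t, so "constant
  Jacobian" turns into "divides t". The value n = 4 is special because the deck group is then the
  quaternion group, in which a diagonal element of order 4 can be conjugate, under a linear lift, to
  an antidiagonal one. All antidiagonal elements have order 4, so for n \<ge> 5 a diagonal element
  of another order, larger than 2, must stay diagonal, and this pins the lift down.\<close>

definition ev :: "complex poly poly \<Rightarrow> complex \<Rightarrow> complex \<Rightarrow> complex" where
  "ev P u v = poly (poly P [:v:]) u"

lemma ev_simps [simp]:
  "ev 0 u v = 0" "ev 1 u v = 1" "ev [:[:c:]:] u v = c"
  "ev (P + Q) u v = ev P u v + ev Q u v" "ev (P - Q) u v = ev P u v - ev Q u v"
  "ev (- P) u v = - ev P u v" "ev (P * Q) u v = ev P u v * ev Q u v" "ev (P ^ k) u v = ev P u v ^ k"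
  by (simp_all add: ev_def)

lemma ev_const_smult [simp]:
  "ev [:a:] u v = poly a u" "ev (Polynomial.smult a P) u v = poly a u * ev P u v"
  "ev (pCons a P) u v = poly a u + v * ev P u v"
  by (simp_all add: ev_def)

lemma poly_eq_0_if_infinite_roots:
  fixes p :: "'a::idom poly"
  assumes "infinite A" "\<And>x. x \<in> A \<Longrightarrow> poly p x = 0"
  shows "p = 0"
proof (rule ccontr)
  assume "p \<noteq> 0"
  then have "finite {x. poly p x = 0}" by (rule poly_roots_finite)
  with assms show False using finite_subset[of A "{x. poly p x = 0}"] by blast
qed

lemma infinite_nonzero_complex: "infinite (- {0 :: complex})"
  by (simp add: infinite_UNIV_char_0 Compl_eq_Diff_UNIV)

text \<open>The outer polynomial is tested at infinitely many constants \<open>[:v:]\<close>, each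
  coefficient test again at infinitely many u. Agreement off the axes is all that is available
  later, where homogeneity is known only there.\<close>

lemma ev_eqI:
  assumes "\<And>u v. u \<noteq> 0 \<Longrightarrow> v \<noteq> 0 \<Longrightarrow> ev P u v = ev Q u v"
  shows "P = Q"
proof -
  have *: "poly (P - Q) [:v:] = 0" if "v \<noteq> 0" for v
    using assms that by (intro poly_eq_0_if_infinite_roots[OF infinite_nonzero_complex]) (simp add: ev_def)
  have "infinite ((\<lambda>v :: complex. [:v:]) ` (- {0}))"
    using infinite_nonzero_complex by (subst finite_image_iff) (auto simp: inj_on_def)
  then have "P - Q = 0"
    by (rule poly_eq_0_if_infinite_roots) (use * in auto)
  then show ?thesis by simp
qed

lemma ev_eq_iff: "P = Q \<longleftrightarrow> (\<forall>u v. ev P u v = ev Q u v)"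
  using ev_eqI by blast

section \<open>Units, powers and coprime factors of polynomials in two variables\<close>

lemma poly2_is_unit_iff:
  fixes P :: "complex poly poly"
  shows "is_unit P \<longleftrightarrow> (\<exists>c. c \<noteq> 0 \<and> P = [:[:c:]:])"
proof
  assume "is_unit P"
  then obtain q where q: "P = [:q:]" "is_unit q"
    by (auto simp: is_unit_poly_iff)
  then obtain c where "q = [:c:]" "is_unit c"
    by (auto simp: is_unit_poly_iff)
  with q show "\<exists>c. c \<noteq> 0 \<and> P = [:[:c:]:]" by auto
qed (auto simp: is_unit_const_poly_iff dvd_field_iff)

lemma ex_complex_root:
  fixes c :: complex assumes "k > 0" shows "\<exists>r. r ^ k = c"
proof -
  have "\<not> constant (poly (Polynomial.monom 1 k - [:c:]))"
  proof
    assume "constant (poly (Polynomial.monom 1 k - [:c:]))"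
    then have "poly (Polynomial.monom 1 k - [:c:]) 0 = poly (Polynomial.monom 1 k - [:c:]) 1"
      unfolding constant_def by blast
    with assms show False by (simp add: poly_monom power_0_left)
  qed
  then obtain r where "poly (Polynomial.monom 1 k - [:c:]) r = 0"
    using fundamental_theorem_of_algebra by blast
  then show ?thesis by (auto simp: poly_monom)
qed

text \<open>Multiplicities determine a power only up to a unit; here the unit is a nonzero constant,
  which has a k-th root over the complex numbers.\<close>

lemma nth_power_if_multiplicities:
  fixes P :: "complex poly poly"
  assumes "k > 0" "\<And>p. Factorial_Ring.prime p \<Longrightarrow> k dvd multiplicity p P"
  shows "\<exists>R. P = R ^ k"
proof (cases "P = 0")
  case True then show ?thesis using assms(1) by (intro exI[of _ 0]) simp
next
  case False
  obtain R where R: "normalize P = R ^ k"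
    using is_nth_power_conv_multiplicity[OF assms(1), of P] assms(2) by (auto simp: is_nth_power_def)
  have "is_unit (unit_factor P)" using False by simp
  then obtain c where c: "unit_factor P = [:[:c:]:]" by (auto simp: poly2_is_unit_iff)
  obtain r where "r ^ k = c" using ex_complex_root[OF assms(1)] by blast
  then have "unit_factor P = [:[:r:]:] ^ k" by (simp add: c ev_eq_iff)
  then have "P = ([:[:r:]:] * R) ^ k"
    using R by (metis power_mult_distrib unit_factor_mult_normalize)
  then show ?thesis by blast
qed

lemma coprime_factor_of_power:
  fixes A B R :: "complex poly poly"
  assumes "k > 0" "A * B = R ^ k" "B \<noteq> 0" "\<And>p. prime_elem p \<Longrightarrow> p dvd A \<Longrightarrow> \<not> p dvd B"
  shows "\<exists>Y. A = Y ^ k"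
proof (cases "A = 0")
  case True then show ?thesis using assms(1) by (intro exI[of _ 0]) simp
next
  case False
  then have "R \<noteq> 0" using assms by (auto simp: power_0_left)
  show ?thesis
  proof (rule nth_power_if_multiplicities[OF assms(1)])
    fix p :: "complex poly poly" assume "Factorial_Ring.prime p"
    then have p: "prime_elem p" by auto
    show "k dvd multiplicity p A"
    proof (cases "p dvd A")
      case True
      then have "multiplicity p B = 0" using assms(4)[OF p] by (simp add: not_dvd_imp_multiplicity_0)
      then have "multiplicity p A = k * multiplicity p R"
        using p False assms(2,3) \<open>R \<noteq> 0\<close>
        by (metis add.right_neutral prime_elem_multiplicity_mult_distrib prime_elem_multiplicity_power_distrib)
      then show ?thesis by simp
    qed (simp add: not_dvd_imp_multiplicity_0)
  qed
qed

text \<open>The quotient of P by R is a unit, hence a constant. This constancy is why two lifts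
  differ by a single deck transformation on the whole plane.\<close>

lemma eq_powers_imp_associated:
  fixes P R :: "complex poly poly"
  assumes "k > 0" "P ^ k = R ^ k"
  shows "\<exists>c. c ^ k = 1 \<and> P = [:[:c:]:] * R"
proof (cases "R = 0")
  case True
  then have "P = 0" using assms by (simp add: power_0_left)
  with True show ?thesis by (intro exI[of _ 1]) simp
next
  case False
  have "R dvd P" using pow_divides_pow_iff[of k R P] assms by simp
  then obtain Q where Q: "P = R * Q" by (rule dvdE)
  then have "R ^ k * Q ^ k = R ^ k * 1" using assms(2) by (simp add: power_mult_distrib)
  then have Qk: "Q ^ k = 1" using False by simp
  then have "is_unit Q" using assms(1) by (metis dvd_power one_dvd is_unit_power_iff)
  then obtain c where c: "Q = [:[:c:]:]" by (auto simp: poly2_is_unit_iff)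
  have "ev (Q ^ k) 0 0 = 1" using Qk by simp
  then have "c ^ k = 1" by (simp add: c)
  then show ?thesis using Q c by (auto simp: mult.commute)
qed

section \<open>Zero sets in the plane\<close>

lemma ev_map_poly: "ev P u v = poly (map_poly (\<lambda>c. poly c u) P) v"
  by (induction P) (simp_all add: ev_def map_poly_pCons)

text \<open>The zeros of a nonunit contain a vertical line or lie over infinitely many u, so that
  finiteness of a fibre can be tested by a polynomial in u alone.\<close>

lemma nonunit_zeros:
  fixes p :: "complex poly poly"
  assumes "\<not> is_unit p"
  shows "(\<exists>u. \<forall>v. ev p u v = 0) \<or> infinite {u. \<exists>v. ev p u v = 0}"
proof (cases "Polynomial.degree p = 0")
  case True
  then obtain q where q: "p = [:q:]" by (auto elim: degree_eq_zeroE)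
  have "\<not> (\<exists>c. c \<noteq> 0 \<and> q = [:c:])" using assms q poly2_is_unit_iff by blast
  then obtain u where "poly q u = 0"
    using fundamental_theorem_of_algebra_alt[of q] by (metis pCons_0_0 poly_0)
  then show ?thesis by (auto simp: q ev_def)
next
  case False
  define l where "l = Polynomial.lead_coeff p"
  have "l \<noteq> 0" using False by (auto simp: l_def)
  \<comment> \<open>Where the leading coefficient does not vanish, specialization at u keeps the
    degree in v positive, so a root v exists.\<close>
  have "\<exists>v. ev p u v = 0" if "poly l u \<noteq> 0" for u
  proof -
    let ?q = "map_poly (\<lambda>c. poly c u) p"
    have "Polynomial.coeff ?q (Polynomial.degree p) \<noteq> 0" using that by (simp add: coeff_map_poly l_def)
    then have "Polynomial.degree ?q \<noteq> 0" using False by (metis le_degree le_zero_eq)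
    then obtain v where "poly ?q v = 0"
      using fundamental_theorem_of_algebra_alt[of ?q] by (metis degree_pCons_0)
    then show ?thesis by (auto simp: ev_map_poly)
  qed
  then have "- {u. poly l u = 0} \<subseteq> {u. \<exists>v. ev p u v = 0}" by auto
  moreover have "infinite (- {u. poly l u = 0})"
    using poly_roots_finite[OF \<open>l \<noteq> 0\<close>] by (simp add: infinite_UNIV_char_0 Compl_eq_Diff_UNIV)
  ultimately show ?thesis using finite_subset by blast
qed

section \<open>The quotient map from the plane and lifts of morphisms\<close>

text \<open>Invariants of the binary dihedral group. With a = u^N, b = v^N and N = 2 (n - 2), the
  constants come from (a + b)^2 - (a - b)^2 = 4 a b: they turn this identity into the equation of
  the surface.\<close>

definition cover :: "nat \<Rightarrow> complex \<Rightarrow> complex \<Rightarrow> point3" where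
  "cover n u v = (u\<^sup>2 * v\<^sup>2, \<i> / 2 * (u ^ (2 * (n - 2)) + v ^ (2 * (n - 2))),
     u * v * (u ^ (2 * (n - 2)) - v ^ (2 * (n - 2))) / 2)"

lemma klein_surface_D_iff:
  assumes "n \<ge> 2"
  shows "(x, y, z) \<in> klein_surface_D n \<longleftrightarrow> x * (x ^ (n - 2) + y\<^sup>2) + z\<^sup>2 = 0"
proof -
  have "n - 1 = Suc (n - 2)" using assms by simp
  then show ?thesis by (simp add: klein_surface_D_def algebra_simps)
qed

lemma cover_in_surface:
  assumes "n \<ge> 2" shows "cover n u v \<in> klein_surface_D n"
proof -
  define a b where "a = u ^ (n - 2)" and "b = v ^ (n - 2)"
  have "u ^ (2 * (n - 2)) = a\<^sup>2" "v ^ (2 * (n - 2)) = b\<^sup>2" "(u\<^sup>2 * v\<^sup>2) ^ (n - 2) = a\<^sup>2 * b\<^sup>2"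
    by (simp_all add: a_def b_def power_mult_distrib mult.commute flip: power_mult)
  moreover have "(u\<^sup>2 * v\<^sup>2) * (a\<^sup>2 * b\<^sup>2 + (\<i> / 2 * (a\<^sup>2 + b\<^sup>2))\<^sup>2) + (u * v * (a\<^sup>2 - b\<^sup>2) / 2)\<^sup>2 = 0"
    by (simp add: power_mult_distrib power_divide) (simp add: field_simps power2_eq_square)
  ultimately show ?thesis
    unfolding cover_def using assms by (simp add: klein_surface_D_iff)
qed

lemma cover_surj:
  assumes "n \<ge> 3" "s \<in> klein_surface_D n"
  shows "\<exists>u v. s = cover n u v"
proof -
  define N where "N = 2 * (n - 2)"
  have N: "N > 0" using assms(1) by (simp add: N_def)
  obtain x y z where s: "s = (x, y, z)" by (cases s)
  have eq: "x * (x ^ (n - 2) + y\<^sup>2) + z\<^sup>2 = 0"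
    using assms by (simp add: s klein_surface_D_iff)
  define w where "w = csqrt x"
  have w: "w\<^sup>2 = x" by (simp add: w_def)
  show ?thesis
  proof (cases "w = 0")
    case True
    with w eq have "x = 0" "z = 0" by auto
    obtain v where "v ^ N = - 2 * \<i> * y" using ex_complex_root[OF N] by blast
    then have "s = cover n 0 v"
      using N by (simp add: s cover_def power_0_left \<open>x = 0\<close> \<open>z = 0\<close> flip: N_def)
    then show ?thesis by blast
  next
    case False
    \<comment> \<open>Solving the last two coordinates of \<open>cover\<close> with u v = w gives
      u^N = - \<i> y + q and v^N = - \<i> y - q. Only u is chosen as a root; v = w / u makes u v = w
      exact.\<close>
    define q where "q = z / w"
    have z: "z = w * q" using False by (simp add: q_def)
    have "w\<^sup>2 * (w ^ N + y\<^sup>2 + q\<^sup>2) = 0"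
      using eq by (simp add: w[symmetric] z N_def power_mult_distrib algebra_simps flip: power_mult)
    then have "w ^ N + y\<^sup>2 + q\<^sup>2 = 0" using False by simp
    then have "w ^ N = - (y\<^sup>2 + q\<^sup>2)" by (simp only: add.assoc add_eq_0_iff2)
    moreover have "(- \<i> * y + q) * (- \<i> * y - q) = - (y\<^sup>2 + q\<^sup>2)"
      by (simp add: algebra_simps power2_eq_square)
    ultimately have wN: "(- \<i> * y + q) * (- \<i> * y - q) = w ^ N" by (simp only:)
    obtain u where u: "u ^ N = - \<i> * y + q" using ex_complex_root[OF N] by blast
    have "u \<noteq> 0" using u wN False N by (auto simp: power_0_left)
    define v where "v = w / u"
    have "u ^ N * v ^ N = w ^ N" using \<open>u \<noteq> 0\<close> by (simp add: v_def power_divide)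
    with wN u have "u ^ N * v ^ N = u ^ N * (- \<i> * y - q)" by simp
    then have v: "v ^ N = - \<i> * y - q" using \<open>u \<noteq> 0\<close> by simp
    have uv: "u * v = w" using \<open>u \<noteq> 0\<close> by (simp add: v_def)
    have "s = cover n u v"
      using u v by (simp add: s cover_def N_def[symmetric] uv z w flip: power_mult_distrib)
    then show ?thesis by blast
  qed
qed

text \<open>A common nonunit factor would vanish along a curve inside one fibre of the first two
  quotient coordinates, but such a fibre contains no vertical line and lies over finitely many
  u.\<close>

lemma cover_fibre_coprime:
  assumes "\<not> is_unit p" "p dvd P" "p dvd Q" "M > 0"
    and P: "\<And>u v. ev P u v = u\<^sup>2 * v\<^sup>2 - a" and Q: "\<And>u v. ev Q u v = c * (u ^ (2 * M) + v ^ (2 * M)) - b"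
    and "c \<noteq> 0"
  shows False
proof -
  have zero: "u\<^sup>2 * v\<^sup>2 = a \<and> u ^ (2 * M) + v ^ (2 * M) = b / c" if "ev p u v = 0" for u v
  proof -
    have "ev P u v = 0" "ev Q u v = 0" using assms(2,3) that by (metis dvdE ev_simps(7) mult_zero_left)+
    then show ?thesis using \<open>c \<noteq> 0\<close> by (simp add: P Q field_simps)
  qed
  from nonunit_zeros[OF assms(1)] show False
  proof
    assume "\<exists>u. \<forall>v. ev p u v = 0"
    then obtain u where "\<forall>v. ev p u v = 0" by blast
    then have eqs: "u\<^sup>2 * v\<^sup>2 = a \<and> u ^ (2 * M) + v ^ (2 * M) = b / c" for v using zero by blast
    from eqs[of 0] eqs[of 1] show False using \<open>M > 0\<close> by (auto simp: power_0_left)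
  next
    assume "infinite {u. \<exists>v. ev p u v = 0}"
    moreover
    \<comment> \<open>Multiplying u^(2M) + v^(2M) = b / c by u^(2M) and using u^2 v^2 = a eliminates
      v; the result is monic of degree 4M.\<close>
    define R where "R = Polynomial.monom 1 (4 * M) - Polynomial.smult (b / c) (Polynomial.monom 1 (2 * M)) + [:a ^ M:]"
    have "poly R u = 0" if ex: "\<exists>v. ev p u v = 0" for u
    proof -
      obtain v where v: "ev p u v = 0" using ex by blast
      have "u ^ (4 * M) + (u\<^sup>2 * v\<^sup>2) ^ M = u ^ (2 * M) * (u ^ (2 * M) + v ^ (2 * M))"
        by (simp add: algebra_simps power_mult_distrib flip: power_mult power_add)
      then have "u ^ (4 * M) + a ^ M = u ^ (2 * M) * (u ^ (2 * M) + v ^ (2 * M))"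
        using zero[OF v] by simp
      also have "\<dots> = u ^ (2 * M) * (b / c)" using zero[OF v] by simp
      finally have "(u ^ (4 * M) + a ^ M) - u ^ (2 * M) * (b / c) = 0" by simp
      then show ?thesis by (simp add: R_def poly_monom algebra_simps)
    qed
    ultimately have "R = 0" by (intro poly_eq_0_if_infinite_roots[of "{u. \<exists>v. ev p u v = 0}"]) auto
    moreover have "Polynomial.coeff R (4 * M) = 1"
      using \<open>M > 0\<close> by (simp add: R_def coeff_pCons split: nat.splits)
    ultimately show False by simp
  qed
qed

text \<open>The second conjunct is congruence modulo q: where the inner components are constant
  along a curve, so is the composite. It is attached to the same R whose values the first conjunct
  gives.\<close>

lemma polynomial_fun3_subst:
  assumes "polynomial_fun3 p"
  shows "\<exists>R. (\<forall>u v. ev R u v = p (ev Px u v, ev Py u v, ev Pz u v)) \<and>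
    (\<forall>q a b c. q dvd Px - [:[:a:]:] \<longrightarrow> q dvd Py - [:[:b:]:] \<longrightarrow> q dvd Pz - [:[:c:]:] \<longrightarrow> q dvd R - [:[:p (a, b, c):]:])"
  using assms
proof induction
  case (const k)
  show ?case by (rule exI[of _ "[:[:k:]:]"]) simp
next
  case coord_x
  show ?case by (rule exI[of _ Px]) simp
next
  case coord_y
  show ?case by (rule exI[of _ Py]) simp
next
  case coord_z
  show ?case by (rule exI[of _ Pz]) simp
next
  case (add f g)
  then obtain R R' where
    R: "\<And>u v. ev R u v = f (ev Px u v, ev Py u v, ev Pz u v)"
      "\<And>q a b c. q dvd Px - [:[:a:]:] \<Longrightarrow> q dvd Py - [:[:b:]:] \<Longrightarrow> q dvd Pz - [:[:c:]:] \<Longrightarrow> q dvd R - [:[:f (a, b, c):]:]"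
    and R': "\<And>u v. ev R' u v = g (ev Px u v, ev Py u v, ev Pz u v)"
      "\<And>q a b c. q dvd Px - [:[:a:]:] \<Longrightarrow> q dvd Py - [:[:b:]:] \<Longrightarrow> q dvd Pz - [:[:c:]:] \<Longrightarrow> q dvd R' - [:[:g (a, b, c):]:]"
    by blast
  have "q dvd (R + R') - [:[:f (a, b, c) + g (a, b, c):]:]"
    if "q dvd Px - [:[:a:]:]" "q dvd Py - [:[:b:]:]" "q dvd Pz - [:[:c:]:]" for q a b c
  proof -
    have "(R + R') - [:[:f (a, b, c) + g (a, b, c):]:] = (R - [:[:f (a, b, c):]:]) + (R' - [:[:g (a, b, c):]:])"
      by (simp add: ev_eq_iff)
    then show ?thesis using R(2)[OF that] R'(2)[OF that] by (metis dvd_add)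
  qed
  then show ?case by (intro exI[of _ "R + R'"]) (simp add: R(1) R'(1))
next
  case (mult f g)
  then obtain R R' where
    R: "\<And>u v. ev R u v = f (ev Px u v, ev Py u v, ev Pz u v)"
      "\<And>q a b c. q dvd Px - [:[:a:]:] \<Longrightarrow> q dvd Py - [:[:b:]:] \<Longrightarrow> q dvd Pz - [:[:c:]:] \<Longrightarrow> q dvd R - [:[:f (a, b, c):]:]"
    and R': "\<And>u v. ev R' u v = g (ev Px u v, ev Py u v, ev Pz u v)"
      "\<And>q a b c. q dvd Px - [:[:a:]:] \<Longrightarrow> q dvd Py - [:[:b:]:] \<Longrightarrow> q dvd Pz - [:[:c:]:] \<Longrightarrow> q dvd R' - [:[:g (a, b, c):]:]"
    by blast
  have "q dvd (R * R') - [:[:f (a, b, c) * g (a, b, c):]:]"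
    if "q dvd Px - [:[:a:]:]" "q dvd Py - [:[:b:]:]" "q dvd Pz - [:[:c:]:]" for q a b c
  proof -
    have "(R * R') - [:[:f (a, b, c) * g (a, b, c):]:] =
        (R - [:[:f (a, b, c):]:]) * R' + [:[:f (a, b, c):]:] * (R' - [:[:g (a, b, c):]:])"
      by (simp only: ev_eq_iff ev_simps) (simp add: algebra_simps)
    then show ?thesis using R(2)[OF that] R'(2)[OF that] by (metis dvd_add dvd_mult dvd_mult2)
  qed
  then show ?case by (intro exI[of _ "R * R'"]) (simp add: R(1) R'(1))
qed

text \<open>The assumption \<open>sep\<close> says that no curve is contracted to a point of the
  line x = z = 0. Its instance b = 0 makes the three components coprime; the other b are there to
  exclude \<open>Px = 0\<close>.\<close>

lemma surface_curve_lift: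
  fixes Px Py Pz :: "complex poly poly"
  assumes n: "n \<ge> 3"
    and eq: "\<And>u v. (ev Px u v, ev Py u v, ev Pz u v) \<in> klein_surface_D n"
    and sep: "\<And>p b. \<not> is_unit p \<Longrightarrow> p dvd Px \<Longrightarrow> p dvd Pz \<Longrightarrow> \<not> p dvd Py - [:[:b:]:]"
  shows "\<exists>U V. U * V \<noteq> 0 \<and> (\<forall>u v. cover n (ev U u v) (ev V u v) = (ev Px u v, ev Py u v, ev Pz u v))"
proof -
  define M N where "M = n - 2" and "N = 2 * M"
  have N: "N > 0" "M > 0" "N = 2 * (n - 2)" using n by (simp_all add: N_def M_def)
  have eqXYZ: "Px * (- (Px ^ M + Py\<^sup>2)) = Pz\<^sup>2"
  proof -
    have "ev Px u v * (ev Px u v ^ M + (ev Py u v)\<^sup>2) + (ev Pz u v)\<^sup>2 = 0" for u v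
      using eq[of u v] n by (simp add: klein_surface_D_iff M_def)
    then have "ev (Px * (- (Px ^ M + Py\<^sup>2))) u v = ev (Pz\<^sup>2) u v" for u v
      by (simp only: ev_simps mult_minus_right neg_eq_iff_add_eq_0)
    then show ?thesis unfolding ev_eq_iff by blast
  qed
  have sep0: "\<not> (p dvd Px \<and> p dvd Py \<and> p dvd Pz)" if "prime_elem p" for p
    using sep[of p 0] that by (auto simp: prime_elem_def)
  have "Px \<noteq> 0"
  proof
    assume "Px = 0"
    then have "Pz = 0" using eqXYZ by simp
    \<comment> \<open>Py minus its value at the origin vanishes at the origin, so it is not a unit;
      it divides itself and the zero polynomials Px and Pz.\<close>
    define b where "b = ev Py 0 0"
    have "\<not> is_unit (Py - [:[:b:]:])"
    proof
      assume "is_unit (Py - [:[:b:]:])"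
      then obtain c where "c \<noteq> 0" "Py - [:[:b:]:] = [:[:c:]:]" using poly2_is_unit_iff by blast
      then have "ev (Py - [:[:b:]:]) 0 0 = c" by simp
      with \<open>c \<noteq> 0\<close> show False by (simp add: b_def)
    qed
    from sep[OF this, of b] \<open>Px = 0\<close> \<open>Pz = 0\<close> show False by simp
  qed
  have nd: "\<not> p dvd - (Px ^ M + Py\<^sup>2)" if p: "prime_elem p" and "p dvd Px" for p
  proof
    assume "p dvd - (Px ^ M + Py\<^sup>2)"
    moreover have "p dvd Px ^ M" using N(2) \<open>p dvd Px\<close> by (simp add: dvd_power_le[of p Px 1 M, simplified])
    ultimately have "p dvd Py\<^sup>2" by (metis dvd_add_right_iff dvd_minus_iff)
    moreover have "p dvd Pz\<^sup>2" using \<open>p dvd Px\<close> eqXYZ by (metis dvd_mult2)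
    ultimately show False using sep0[OF p] \<open>p dvd Px\<close> p prime_elem_dvd_power by blast
  qed
  obtain W where W: "Px = W\<^sup>2"
  \<comment> \<open>If the cofactor of Px is 0, multiplicities give no information; but then
    \<open>nd\<close> leaves Px without prime divisors, so it is a constant and a square.\<close>
  proof (cases "Px ^ M + Py\<^sup>2 = 0")
    case True
    have "is_unit Px"
    proof (rule ccontr)
      assume "\<not> is_unit Px"
      then obtain p where "prime_elem p" "p dvd Px"
        using \<open>Px \<noteq> 0\<close> prime_divisor_exists[of Px] by (metis prime_imp_prime_elem)
      with nd True show False by fastforce
    qed
    then obtain c where "Px = [:[:c:]:]" using poly2_is_unit_iff by blast
    then have "Px = [:[:csqrt c:]:]\<^sup>2" by (simp add: ev_eq_iff)
    then show ?thesis using that by blast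
  next
    case False
    then have "\<exists>W. Px = W\<^sup>2"
      by (intro coprime_factor_of_power[OF _ eqXYZ _ nd]) (simp_all only: neg_equal_0_iff_equal zero_less_numeral not_False_eq_True)
    then show ?thesis using that by blast
  qed
  have "W \<noteq> 0" using W \<open>Px \<noteq> 0\<close> by auto
  have "W\<^sup>2 dvd Pz\<^sup>2" using eqXYZ W by (metis dvd_triv_left)
  then have "W dvd Pz" by simp
  then obtain Q where Q: "Pz = W * Q" by (rule dvdE)
  define J :: "complex poly poly" where "J = [:[:\<i>:]:]"
  \<comment> \<open>The factors of - (Q^2 + Py^2) over \<i>, with signs matching
    \<open>cover\<close>: A + B = - 2 \<i> Py and A - B = 2 Q are to become U^N + V^N and U^N -
    V^N.\<close>
  define A B where "A = Q - J * Py" and "B = - (J * Py) - Q"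
  have J: "J * J = - 1" by (simp add: ev_eq_iff J_def)
  have "W\<^sup>2 * (- (W ^ N + Py\<^sup>2)) = W\<^sup>2 * Q\<^sup>2"
    using eqXYZ by (simp add: W Q N_def power_mult power_mult_distrib)
  then have WN: "- (W ^ N + Py\<^sup>2) = Q\<^sup>2" using \<open>W \<noteq> 0\<close> by simp
  have AB: "A * B = W ^ N"
  proof -
    have "A * B = (J * J) * Py\<^sup>2 - Q\<^sup>2" by (simp add: A_def B_def algebra_simps power2_eq_square)
    then show ?thesis by (simp add: J WN[symmetric])
  qed
  have "A \<noteq> 0" "B \<noteq> 0" using AB \<open>W \<noteq> 0\<close> by auto
  have AB_coprime: "\<not> p dvd B" if p: "prime_elem p" and "p dvd A" for p
  proof
    assume "p dvd B"
    have "2 * Q = A - B" "2 * Py = J * (A + B)"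
      by (simp_all add: A_def B_def algebra_simps J flip: mult.assoc)
    then have "p dvd 2 * Q" "p dvd 2 * Py" using \<open>p dvd A\<close> \<open>p dvd B\<close> by (metis dvd_diff, metis dvd_add dvd_mult)
    moreover have "is_unit (2 :: complex poly poly)"
      by (simp add: poly2_is_unit_iff ev_eq_iff numeral_poly)
    ultimately have "p dvd Q" "p dvd Py" by (simp_all add: dvd_mult_unit_iff')
    moreover have "p dvd W" using p AB \<open>p dvd A\<close> by (metis dvd_mult2 prime_elem_dvd_power)
    ultimately have "p dvd Px" "p dvd Py" "p dvd Pz" by (auto simp: W Q power2_eq_square)
    with sep0[OF p] show False by blast
  qed
  obtain U where U: "A = U ^ N"
    using coprime_factor_of_power[OF N(1) AB \<open>B \<noteq> 0\<close>] AB_coprime by blast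
  \<comment> \<open>V is W / U and not an arbitrary N-th root of B: the product U V must be W
    itself, not W times a root of unity.\<close>
  have "U ^ N dvd W ^ N" using AB U by (metis dvd_triv_left)
  then have "U dvd W" using N(1) by simp
  then obtain V where V: "W = U * V" by (rule dvdE)
  have "U ^ N * B = U ^ N * V ^ N" using AB U V by (simp add: power_mult_distrib)
  moreover have "U ^ N \<noteq> 0" using \<open>A \<noteq> 0\<close> U by simp
  ultimately have B: "B = V ^ N" by (simp only: mult_cancel_left simp_thms)
  have "cover n (ev U u v) (ev V u v) = (ev Px u v, ev Py u v, ev Pz u v)" for u v
  proof -
    have "ev U u v ^ N = ev Q u v - \<i> * ev Py u v" "ev V u v ^ N = - (\<i> * ev Py u v) - ev Q u v"
      using arg_cong[OF U, of "\<lambda>P. ev P u v"] arg_cong[OF B, of "\<lambda>P. ev P u v"]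
      by (simp_all add: A_def B_def J_def)
    then show ?thesis
      by (simp add: cover_def N(3)[symmetric] W Q V power_mult_distrib)
  qed
  moreover have "U * V \<noteq> 0" using V \<open>W \<noteq> 0\<close> by simp
  ultimately show ?thesis by blast
qed

text \<open>The first coordinate fixes U V up to a sign e. The other two then give the sum of U'^N
  and V'^N, and e times their difference, so U'^N is U^N for e = 1 and V^N for e = - 1. Roots of
  equal powers differ by a constant.\<close>

lemma cover_deck:
  fixes U V U' V' :: "complex poly poly"
  assumes n: "n \<ge> 3" and nz: "U * V \<noteq> 0"
    and eq: "\<And>u v. cover n (ev U' u v) (ev V' u v) = cover n (ev U u v) (ev V u v)"
  shows "\<exists>c. c ^ (2 * (n - 2)) = 1 \<and>
    (U' = [:[:c:]:] * U \<and> V' = [:[:inverse c:]:] * V \<or> U' = [:[:c:]:] * V \<and> V' = - [:[:inverse c:]:] * U)"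
proof -
  define N where "N = 2 * (n - 2)"
  have N: "N > 0" using n by (simp add: N_def)
  have "(U' * V')\<^sup>2 = (U * V)\<^sup>2"
    using eq by (simp add: cover_def ev_eq_iff power_mult_distrib)
  then obtain e where e: "e\<^sup>2 = 1" "U' * V' = [:[:e:]:] * (U * V)"
    using eq_powers_imp_associated[of 2 "U' * V'" "U * V"] by auto
  have sum: "U' ^ N + V' ^ N = U ^ N + V ^ N"
    using eq by (simp add: cover_def ev_eq_iff N_def)
  have "(U' * V') * (U' ^ N - V' ^ N) = (U * V) * (U ^ N - V ^ N)"
    using eq by (simp add: cover_def ev_eq_iff N_def)
  then have "(U * V) * ([:[:e:]:] * (U' ^ N - V' ^ N)) = (U * V) * (U ^ N - V ^ N)"
    by (simp only: e(2) mult_ac)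
  then have diff: "[:[:e:]:] * (U' ^ N - V' ^ N) = U ^ N - V ^ N" using nz by (simp only: mult_cancel_left) simp
  have root_inv: "[:[:c:]:] * [:[:inverse c:]:] = (1 :: complex poly poly)" if "c ^ N = 1" for c :: complex
  proof -
    have "c \<noteq> 0" using that N by (auto simp: power_0_left)
    then have "c * inverse c = 1" by simp
    then show ?thesis by (simp only: ev_eq_iff ev_simps) simp
  qed
  have inv_scale: "R = [:[:inverse c:]:] * ([:[:c:]:] * R)" if "c ^ N = 1" for c :: complex and R
  proof -
    have "R = ([:[:c:]:] * [:[:inverse c:]:]) * R" by (simp only: root_inv[OF that] mult_1)
    then show ?thesis by (simp only: mult_ac)
  qed
  have cancel: "a = c" if "a + b = c + d" "a - b = c - d" for a b c d :: complex
  proof -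
    have "2 * a = (a + b) + (a - b)" by simp
    also have "\<dots> = 2 * c" unfolding that by simp
    finally show ?thesis by simp
  qed
  from e(1) have "e = 1 \<or> e = - 1" by (simp add: power2_eq_1_iff)
  then show ?thesis
  proof
    assume "e = 1"
    have "ev U' u v ^ N = ev U u v ^ N" for u v
    proof (rule cancel)
      show "ev U' u v ^ N + ev V' u v ^ N = ev U u v ^ N + ev V u v ^ N"
        using arg_cong[OF sum, of "\<lambda>P. ev P u v"] by simp
      show "ev U' u v ^ N - ev V' u v ^ N = ev U u v ^ N - ev V u v ^ N"
        using arg_cong[OF diff, of "\<lambda>P. ev P u v"] \<open>e = 1\<close> by (simp only: ev_simps mult_1)
    qed
    then have "U' ^ N = U ^ N" by (simp add: ev_eq_iff)
    then obtain c where c: "c ^ N = 1" "U' = [:[:c:]:] * U"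
      using eq_powers_imp_associated[OF N] by blast
    have "U * ([:[:c:]:] * V') = U * V" 
      using e(2) \<open>e = 1\<close> c(2) by (simp add: mult_ac flip: one_pCons)
    then have "[:[:c:]:] * V' = V" using nz by (simp only: mult_cancel_left) auto
    then have "V' = [:[:inverse c:]:] * V" using inv_scale[OF c(1)] by metis
    with c show ?thesis unfolding N_def by blast
  next
    assume "e = - 1"
    have "ev U' u v ^ N = ev V u v ^ N" for u v
    proof (rule cancel)
      show "ev U' u v ^ N + ev V' u v ^ N = ev V u v ^ N + ev U u v ^ N"
        using arg_cong[OF sum, of "\<lambda>P. ev P u v"] by (simp add: add.commute)
      show "ev U' u v ^ N - ev V' u v ^ N = ev V u v ^ N - ev U u v ^ N"
        using arg_cong[OF diff, of "\<lambda>P. ev P u v"] \<open>e = - 1\<close>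
        by (simp only: ev_simps mult_minus_left mult_1 minus_diff_eq) (metis minus_diff_eq)
    qed
    then have "U' ^ N = V ^ N" by (simp add: ev_eq_iff)
    then obtain c where c: "c ^ N = 1" "U' = [:[:c:]:] * V"
      using eq_powers_imp_associated[OF N] by blast
    have "V * ([:[:c:]:] * V') = V * (- U)" 
      using arg_cong[OF e(2), of "\<lambda>P. ev P u v" for u v] \<open>e = - 1\<close> c(2) by (simp add: ev_eq_iff mult_ac)
    then have "[:[:c:]:] * V' = - U" using nz by (simp only: mult_cancel_left) auto
    then have "V' = [:[:inverse c:]:] * (- U)" using inv_scale[OF c(1)] by metis
    then have "V' = - [:[:inverse c:]:] * U" by (simp only: mult_minus_left mult_minus_right)
    with c show ?thesis unfolding N_def by blast
  qed
qed

text \<open>The inverse g supplies the separation hypothesis: if f after \<open>cover\<close> were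
  constant along a curve, then so would be the first two coordinates of \<open>cover\<close>, which
  are polynomials in it through g.\<close>

lemma automorphism_lift_poly:
  assumes n: "n \<ge> 3" and f: "regular_map3 (klein_surface_D n) f" "f \<in> klein_surface_D n \<rightarrow> klein_surface_D n"
    and g: "regular_map3 (klein_surface_D n) g" "\<And>s. s \<in> klein_surface_D n \<Longrightarrow> g (f s) = s"
  shows "\<exists>U V. U * V \<noteq> 0 \<and> (\<forall>u v. cover n (ev U u v) (ev V u v) = f (cover n u v))"
proof -
  let ?S = "klein_surface_D n"
  obtain p1 p2 p3 where p: "polynomial_fun3 p1" "polynomial_fun3 p2" "polynomial_fun3 p3"
    "\<And>v. v \<in> ?S \<Longrightarrow> f v = (p1 v, p2 v, p3 v)"
    using f(1) unfolding regular_map3_def by blast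
  obtain q1 q2 q3 where q: "polynomial_fun3 q1" "polynomial_fun3 q2" "polynomial_fun3 q3"
    "\<And>v. v \<in> ?S \<Longrightarrow> g v = (q1 v, q2 v, q3 v)"
    using g(1) unfolding regular_map3_def by blast
  \<comment> \<open>The inner variable is u, the outer one is v.\<close>
  define u0 v0 :: "complex poly poly" where "u0 = [:[:0, 1:]:]" and "v0 = [:0, 1:]"
  have [simp]: "ev u0 u v = u" "ev v0 u v = v" for u v by (simp_all add: u0_def v0_def)
  define Cx Cy Cz where "Cx = u0\<^sup>2 * v0\<^sup>2" and "Cy = [:[:\<i> / 2:]:] * (u0 ^ (2 * (n - 2)) + v0 ^ (2 * (n - 2)))"
    and "Cz = [:[:1 / 2:]:] * (u0 * v0 * (u0 ^ (2 * (n - 2)) - v0 ^ (2 * (n - 2))))"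
  have C: "(ev Cx u v, ev Cy u v, ev Cz u v) = cover n u v" for u v
    by (simp add: Cx_def Cy_def Cz_def cover_def)
  have Cxy: "ev Cx u v = fst (cover n u v)" "ev Cy u v = fst (snd (cover n u v))" for u v
    using C[of u v] by (metis fst_conv snd_conv)+
  have S: "cover n u v \<in> ?S" for u v using n by (simp add: cover_in_surface)
  obtain Px where Px: "\<And>u v. ev Px u v = p1 (cover n u v)"
    using polynomial_fun3_subst[OF p(1), of Cx Cy Cz] unfolding C by blast
  obtain Py where Py: "\<And>u v. ev Py u v = p2 (cover n u v)"
    using polynomial_fun3_subst[OF p(2), of Cx Cy Cz] unfolding C by blast
  obtain Pz where Pz: "\<And>u v. ev Pz u v = p3 (cover n u v)"
    using polynomial_fun3_subst[OF p(3), of Cx Cy Cz] unfolding C by blast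
  have P: "(ev Px u v, ev Py u v, ev Pz u v) = f (cover n u v)" for u v
    by (simp add: Px Py Pz p(4)[OF S])
  have fS: "f (cover n u v) \<in> ?S" for u v using f(2) S by blast
  have qf: "q1 (f (cover n u v)) = fst (cover n u v)" "q2 (f (cover n u v)) = fst (snd (cover n u v))" for u v
    using g(2)[OF S[of u v]] q(4)[OF fS[of u v]] by (metis fst_conv snd_conv)+
  obtain R1 where R1: "\<And>u v. ev R1 u v = q1 (f (cover n u v))"
    "\<And>q a b c. q dvd Px - [:[:a:]:] \<Longrightarrow> q dvd Py - [:[:b:]:] \<Longrightarrow> q dvd Pz - [:[:c:]:] \<Longrightarrow> q dvd R1 - [:[:q1 (a, b, c):]:]"
    using polynomial_fun3_subst[OF q(1), of Px Py Pz] unfolding P by blast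
  obtain R2 where R2: "\<And>u v. ev R2 u v = q2 (f (cover n u v))"
    "\<And>q a b c. q dvd Px - [:[:a:]:] \<Longrightarrow> q dvd Py - [:[:b:]:] \<Longrightarrow> q dvd Pz - [:[:c:]:] \<Longrightarrow> q dvd R2 - [:[:q2 (a, b, c):]:]"
    using polynomial_fun3_subst[OF q(2), of Px Py Pz] unfolding P by blast
  have sep: "\<not> p dvd Py - [:[:b:]:]" if "\<not> is_unit p" "p dvd Px" "p dvd Pz" for p b
  proof
    assume "p dvd Py - [:[:b:]:]"
    then have "p dvd R1 - [:[:q1 (0, b, 0):]:]" "p dvd R2 - [:[:q2 (0, b, 0):]:]"
      using that R1(2)[of p 0 b 0] R2(2)[of p 0 b 0] by simp_all
    then show False
    proof (rule cover_fibre_coprime[OF that(1)])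
      show "n - 2 > 0" using n by simp
      show "ev (R1 - [:[:q1 (0, b, 0):]:]) u v = u\<^sup>2 * v\<^sup>2 - q1 (0, b, 0)" for u v
        by (simp add: R1(1) qf) (simp add: cover_def)
      show "ev (R2 - [:[:q2 (0, b, 0):]:]) u v = \<i> / 2 * (u ^ (2 * (n - 2)) + v ^ (2 * (n - 2))) - q2 (0, b, 0)" for u v
        by (simp add: R2(1) qf) (simp add: cover_def)
    qed simp
  qed
  show ?thesis
    using surface_curve_lift[OF n, of Px Py Pz] fS sep unfolding P by blast
qed

section \<open>The deck group and equivariance of lifts\<close>

lemma poly2_induct [case_names const fst snd add mult]:
  assumes const: "\<And>c. Q [:[:c:]:]" and fst: "Q [:[:0, 1:]:]" and snd: "Q [:0, 1:]"
    and add: "\<And>A B. Q A \<Longrightarrow> Q B \<Longrightarrow> Q (A + B)" and mult: "\<And>A B. Q A \<Longrightarrow> Q B \<Longrightarrow> Q (A * B)"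
  shows "Q (P :: complex poly poly)"
proof -
  have inner: "Q [:a:]" for a
  proof (induction a)
    case 0
    show ?case using const[of 0] by simp
  next
    case (pCons c a)
    have "[:pCons c a:] = [:[:c:]:] + [:[:0, 1:]:] * [:a:]" by (simp add: ev_eq_iff)
    then show ?case using add const mult fst pCons.IH by metis
  qed
  show ?thesis
  proof (induction P)
    case 0
    show ?case using const[of 0] by simp
  next
    case (pCons a P)
    have "pCons a P = [:a:] + [:0, 1:] * P" by simp
    then show ?case using add inner mult snd pCons.IH by metis
  qed
qed

abbreviation cov :: "nat \<Rightarrow> complex \<times> complex \<Rightarrow> point3" where
  "cov n p \<equiv> cover n (fst p) (snd p)"

definition polymap2 :: "(complex \<times> complex \<Rightarrow> complex \<times> complex) \<Rightarrow> bool" where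
  "polymap2 \<Phi> \<longleftrightarrow> (\<exists>U V. \<forall>u v. \<Phi> (u, v) = (ev U u v, ev V u v))"

lemma ev_compose: "\<exists>R. \<forall>u v. ev R u v = ev P (ev A u v) (ev B u v)"
proof (induction P rule: poly2_induct)
  case (const c) show ?case by (intro exI[of _ "[:[:c:]:]"]) simp
next
  case fst show ?case by (intro exI[of _ A]) simp
next
  case snd show ?case by (intro exI[of _ B]) simp
next
  case (add P Q)
  then obtain R R' where "\<forall>u v. ev R u v = ev P (ev A u v) (ev B u v)" "\<forall>u v. ev R' u v = ev Q (ev A u v) (ev B u v)"
    by blast
  then show ?case by (intro exI[of _ "R + R'"]) simp
next
  case (mult P Q)
  then obtain R R' where "\<forall>u v. ev R u v = ev P (ev A u v) (ev B u v)" "\<forall>u v. ev R' u v = ev Q (ev A u v) (ev B u v)"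
    by blast
  then show ?case by (intro exI[of _ "R * R'"]) simp
qed

lemma polymap2_comp:
  assumes "polymap2 \<Phi>" "polymap2 \<Psi>" shows "polymap2 (\<lambda>p. \<Phi> (\<Psi> p))"
proof -
  obtain U V A B where "\<forall>u v. \<Phi> (u, v) = (ev U u v, ev V u v)" "\<forall>u v. \<Psi> (u, v) = (ev A u v, ev B u v)"
    using assms unfolding polymap2_def by blast
  moreover obtain R where "\<forall>u v. ev R u v = ev U (ev A u v) (ev B u v)" using ev_compose by blast
  moreover obtain R' where "\<forall>u v. ev R' u v = ev V (ev A u v) (ev B u v)" using ev_compose by blast
  ultimately show ?thesis unfolding polymap2_def by (intro exI[of _ R] exI[of _ R']) simp
qed

definition diag2 :: "complex \<Rightarrow> complex \<times> complex \<Rightarrow> complex \<times> complex" where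
  "diag2 c p = (c * fst p, inverse c * snd p)"

definition anti2 :: "complex \<Rightarrow> complex \<times> complex \<Rightarrow> complex \<times> complex" where
  "anti2 c p = (c * snd p, - inverse c * fst p)"

text \<open>The binary dihedral group of order \<open>4 (n - 2)\<close>, the deck group of \<^const>\<open>cover\<close>.\<close>

definition decks :: "nat \<Rightarrow> (complex \<times> complex \<Rightarrow> complex \<times> complex) set" where
  "decks n = diag2 ` {c. c ^ (2 * (n - 2)) = 1} \<union> anti2 ` {c. c ^ (2 * (n - 2)) = 1}"

lemma cov_decks:
  assumes "\<delta> \<in> decks n" "n \<ge> 3" shows "cov n (\<delta> p) = cov n p"
proof -
  define N where "N = 2 * (n - 2)"
  obtain c where c: "c ^ N = 1" "\<delta> = diag2 c \<or> \<delta> = anti2 c"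
    using assms(1) by (auto simp: decks_def N_def)
  have "c \<noteq> 0" using c assms(2) by (auto simp: N_def power_0_left)
  then have m: "c * a * (inverse c * b) = a * b" "c\<^sup>2 * a\<^sup>2 * ((inverse c)\<^sup>2 * b\<^sup>2) = a\<^sup>2 * b\<^sup>2" for a b
    by (simp_all add: field_simps)
  have "inverse c ^ N = 1" "even N" using c by (simp_all add: power_inverse N_def)
  then show ?thesis
    using c \<open>c \<noteq> 0\<close> by (auto simp: cover_def diag2_def anti2_def power_mult_distrib mult_ac simp flip: N_def)
      (simp_all add: field_simps)
qed

lemma polymap2_decks:
  assumes "\<delta> \<in> decks n" shows "polymap2 \<delta>"
proof -
  obtain c where c: "\<delta> = diag2 c \<or> \<delta> = anti2 c"
    using assms(1) by (auto simp: decks_def)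
  then show ?thesis
  proof
    assume "\<delta> = diag2 c"
    then show ?thesis unfolding polymap2_def
      by (intro exI[of _ "[:[:c:]:] * [:[:0, 1:]:]"] exI[of _ "[:[:inverse c:]:] * [:0, 1:]"]) (simp add: diag2_def)
  next
    assume "\<delta> = anti2 c"
    then show ?thesis unfolding polymap2_def
      by (intro exI[of _ "[:[:c:]:] * [:0, 1:]"] exI[of _ "[:[:- inverse c:]:] * [:[:0, 1:]:]"]) (simp add: anti2_def)
  qed
qed

lemma decks_quotient:
  assumes "\<epsilon> \<in> decks n" "\<delta> \<in> decks n" "n \<ge> 3"
  shows "\<exists>\<gamma>\<in>decks n. \<forall>p. \<epsilon> (\<gamma> p) = \<delta> p"
proof -
  define N where "N = 2 * (n - 2)"
  have N: "even N" "N > 0" using assms(3) by (simp_all add: N_def)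
  obtain c d where c: "c ^ N = 1" "\<epsilon> = diag2 c \<or> \<epsilon> = anti2 c" and d: "d ^ N = 1" "\<delta> = diag2 d \<or> \<delta> = anti2 d"
    using assms(1,2) by (auto simp: decks_def N_def)
  have nz: "c \<noteq> 0" "d \<noteq> 0" using c(1) d(1) N by (auto simp: power_0_left)
  \<comment> \<open>The minus sign arises because \<open>anti2 c\<close> after
    \<open>anti2 e\<close> is \<open>diag2 (- c / e)\<close>; evenness of N absorbs it.\<close>
  have pw: "(d / c) ^ N = 1" "(c / d) ^ N = 1" "(- (c / d)) ^ N = 1"
    using c(1) d(1) N by (simp_all add: power_divide power_minus_even)
  have mem: "diag2 e \<in> decks n" "anti2 e \<in> decks n" if "e ^ N = 1" for e
    using that by (auto simp: decks_def N_def)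
  consider "\<epsilon> = diag2 c" "\<delta> = diag2 d" | "\<epsilon> = diag2 c" "\<delta> = anti2 d"
    | "\<epsilon> = anti2 c" "\<delta> = diag2 d" | "\<epsilon> = anti2 c" "\<delta> = anti2 d" using c d by blast
  then show ?thesis
  proof cases
    case 1 then show ?thesis using nz
      by (intro bexI[OF _ mem(1)[OF pw(1)]]) (simp add: diag2_def field_simps)
  next
    case 2 then show ?thesis using nz
      by (intro bexI[OF _ mem(2)[OF pw(1)]]) (simp add: diag2_def anti2_def field_simps)
  next
    case 3 then show ?thesis using nz
      by (intro bexI[OF _ mem(2)[OF pw(3)]]) (simp add: diag2_def anti2_def field_simps)
  next
    case 4 then show ?thesis using nz
      by (intro bexI[OF _ mem(1)[OF pw(2)]]) (simp add: diag2_def anti2_def field_simps)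
  qed
qed

lemma lift_unique:
  assumes n: "n \<ge> 3" and "polymap2 \<Phi>" "polymap2 \<Phi>'"
    and nz: "fst (\<Phi> p) * snd (\<Phi> p) \<noteq> 0"
    and eq: "\<And>p. cov n (\<Phi>' p) = cov n (\<Phi> p)"
  shows "\<exists>\<delta>\<in>decks n. \<forall>p. \<Phi>' p = \<delta> (\<Phi> p)"
proof -
  obtain U V where U: "\<And>u v. \<Phi> (u, v) = (ev U u v, ev V u v)"
    using assms(2) unfolding polymap2_def by blast
  obtain U' V' where U': "\<And>u v. \<Phi>' (u, v) = (ev U' u v, ev V' u v)"
    using assms(3) unfolding polymap2_def by blast
  obtain u v where "p = (u, v)" by fastforce
  with nz have "ev (U * V) u v \<noteq> 0" by (simp add: U)
  then have "U * V \<noteq> 0" by (metis ev_simps(1))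
  moreover have "cover n (ev U' u v) (ev V' u v) = cover n (ev U u v) (ev V u v)" for u v
    using eq[of "(u, v)"] by (simp add: U U')
  ultimately obtain c where c: "c ^ (2 * (n - 2)) = 1"
    "U' = [:[:c:]:] * U \<and> V' = [:[:inverse c:]:] * V \<or> U' = [:[:c:]:] * V \<and> V' = - [:[:inverse c:]:] * U"
    using cover_deck[OF n] by blast
  from c(2) show ?thesis
  proof
    assume "U' = [:[:c:]:] * U \<and> V' = [:[:inverse c:]:] * V"
    then have "\<Phi>' (u, v) = diag2 c (\<Phi> (u, v))" for u v by (simp add: U U' diag2_def)
    then show ?thesis using c(1) by (auto simp: decks_def)
  next
    assume "U' = [:[:c:]:] * V \<and> V' = - [:[:inverse c:]:] * U"
    then have "\<Phi>' (u, v) = anti2 c (\<Phi> (u, v))" for u v by (simp add: U U' anti2_def)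
    then show ?thesis using c(1) by (auto simp: decks_def)
  qed
qed

lemma automorphism_lift:
  assumes n: "n \<ge> 3" and f: "regular_map3 (klein_surface_D n) f" "f \<in> klein_surface_D n \<rightarrow> klein_surface_D n"
    and g: "regular_map3 (klein_surface_D n) g" "\<And>s. s \<in> klein_surface_D n \<Longrightarrow> g (f s) = s"
  shows "\<exists>\<Phi>. polymap2 \<Phi> \<and> (\<exists>p. fst (\<Phi> p) * snd (\<Phi> p) \<noteq> 0) \<and> (\<forall>p. cov n (\<Phi> p) = f (cov n p))"
proof -
  obtain U V where UV: "U * V \<noteq> 0" "\<And>u v. cover n (ev U u v) (ev V u v) = f (cover n u v)"
    using automorphism_lift_poly[OF assms] by blast
  obtain u v where "ev (U * V) u v \<noteq> 0" using UV(1) by (auto simp: ev_eq_iff)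
  then have "fst (ev U u v, ev V u v) * snd (ev U u v, ev V u v) \<noteq> 0" by simp
  then show ?thesis
    using UV(2) by (intro exI[of _ "\<lambda>p. (ev U (fst p) (snd p), ev V (fst p) (snd p))"])
      (auto simp: polymap2_def)
qed

text \<open>Conjugation by a lift induces a surjection of the deck group onto itself.\<close>

lemma lift_equivariant:
  assumes n: "n \<ge> 3"
    and \<Phi>: "polymap2 \<Phi>" "\<And>p. cov n (\<Phi> p) = f (cov n p)"
    and \<Psi>: "polymap2 \<Psi>" "\<And>p. cov n (\<Psi> p) = g (cov n p)"
    and fg: "\<And>p. g (f (cov n p)) = cov n p" "\<And>p. f (g (cov n p)) = cov n p"
    and \<delta>: "\<delta> \<in> decks n"
  shows "\<exists>\<gamma>\<in>decks n. \<forall>p. \<delta> (\<Phi> p) = \<Phi> (\<gamma> p)"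
proof -
  have id: "polymap2 (\<lambda>p. p)"
    unfolding polymap2_def by (intro exI[of _ "[:[:0, 1:]:]"] exI[of _ "[:0, 1:]"]) simp
  have nz: "fst (1, 1) * snd (1 :: complex, 1 :: complex) \<noteq> 0" by simp
  obtain \<epsilon> where \<epsilon>: "\<epsilon> \<in> decks n" "\<And>p. \<Phi> (\<Psi> p) = \<epsilon> p"
    using lift_unique[OF n id polymap2_comp[OF \<Phi>(1) \<Psi>(1)] nz] by (auto simp: \<Phi>(2) \<Psi>(2) fg)
  obtain \<gamma>0 where \<gamma>0: "\<gamma>0 \<in> decks n" "\<And>p. \<epsilon> (\<gamma>0 p) = \<delta> p"
    using decks_quotient[OF \<epsilon>(1) \<delta> n] by blast
  \<comment> \<open>This composite lifts the identity, so it is a deck transformation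
    \<open>\<gamma>\<close>. Applying \<open>\<Phi>\<close> to it gives \<open>\<epsilon>\<close>
    after \<open>\<gamma>0\<close> after \<open>\<Phi>\<close>, which is \<open>\<delta>\<close>
    after \<open>\<Phi>\<close>.\<close>
  have "polymap2 (\<lambda>p. \<Psi> (\<gamma>0 (\<Phi> p)))"
    by (intro polymap2_comp[OF \<Psi>(1)] polymap2_comp[OF polymap2_decks[OF \<gamma>0(1)]] \<Phi>(1))
  moreover have "cov n (\<Psi> (\<gamma>0 (\<Phi> p))) = cov n p" for p
    by (simp only: \<Phi>(2) \<Psi>(2) cov_decks[OF \<gamma>0(1) n] fg)
  ultimately obtain \<gamma> where "\<gamma> \<in> decks n" "\<And>p. \<Psi> (\<gamma>0 (\<Phi> p)) = \<gamma> p"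
    using lift_unique[OF n id _ nz] by blast
  then show ?thesis using \<epsilon>(2) \<gamma>0(2) by metis
qed

section \<open>The Jacobian bracket and top-degree coefficients\<close>

text \<open>The partial derivative in the inner variable u; \<open>pderiv\<close> on the nested
  polynomial is the one in the outer variable v.\<close>

definition Dfst :: "complex poly poly \<Rightarrow> complex poly poly" where
  "Dfst P = map_poly pderiv P"

lemma Dfst_pCons [simp]: "Dfst (pCons a P) = pCons (pderiv a) (Dfst P)"
  by (simp add: Dfst_def map_poly_pCons)

lemma Dfst_0 [simp]: "Dfst 0 = 0"
  by (simp add: Dfst_def)

lemma Dfst_add: "Dfst (P + Q) = Dfst P + Dfst Q"
  by (rule poly_eqI) (simp add: Dfst_def coeff_map_poly pderiv_add)

lemma Dfst_smult: "Dfst (Polynomial.smult a P) = Polynomial.smult (pderiv a) P + Polynomial.smult a (Dfst P)"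
  by (rule poly_eqI) (simp add: Dfst_def coeff_map_poly pderiv_mult mult.commute)

lemma Dfst_mult: "Dfst (P * Q) = P * Dfst Q + Dfst P * Q"
  by (induction P) (simp_all add: Dfst_add Dfst_smult algebra_simps)

definition bracket :: "complex poly poly \<Rightarrow> complex poly poly \<Rightarrow> complex poly poly" where
  "bracket A B = Dfst A * pderiv B - pderiv A * Dfst B"

text \<open>C and D stand for the partial derivatives of P at (A, B). They stay unspecified because
  multiplicativity of the Jacobian is needed only as a divisibility.\<close>

lemma chain_rule:
  "\<exists>R C D. (\<forall>u v. ev R u v = ev P (ev A u v) (ev B u v)) \<and>
     Dfst R = C * Dfst A + D * Dfst B \<and> pderiv R = C * pderiv A + D * pderiv B"
proof (induction P rule: poly2_induct)
  case (const c) show ?case by (intro exI[of _ "[:[:c:]:]"] exI[of _ 0]) simp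
next
  case fst show ?case by (intro exI[of _ A] exI[of _ 1] exI[of _ 0]) simp
next
  case snd show ?case by (intro exI[of _ B] exI[of _ 0] exI[of _ 1]) simp
next
  case (add P Q)
  then obtain R C D R' C' D' where
    "\<forall>u v. ev R u v = ev P (ev A u v) (ev B u v)" "Dfst R = C * Dfst A + D * Dfst B" "pderiv R = C * pderiv A + D * pderiv B"
    "\<forall>u v. ev R' u v = ev Q (ev A u v) (ev B u v)" "Dfst R' = C' * Dfst A + D' * Dfst B" "pderiv R' = C' * pderiv A + D' * pderiv B"
    by blast
  then show ?case
    by (intro exI[of _ "R + R'"] exI[of _ "C + C'"] exI[of _ "D + D'"])
      (simp add: Dfst_add pderiv_add algebra_simps)
next
  case (mult P Q)
  then obtain R C D R' C' D' where
    "\<forall>u v. ev R u v = ev P (ev A u v) (ev B u v)" "Dfst R = C * Dfst A + D * Dfst B" "pderiv R = C * pderiv A + D * pderiv B"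
    "\<forall>u v. ev R' u v = ev Q (ev A u v) (ev B u v)" "Dfst R' = C' * Dfst A + D' * Dfst B" "pderiv R' = C' * pderiv A + D' * pderiv B"
    by blast
  then show ?case
    by (intro exI[of _ "R * R'"] exI[of _ "R * C' + R' * C"] exI[of _ "R * D' + R' * D"])
      (simp add: Dfst_mult pderiv_mult algebra_simps)
qed

lemma bracket_dvd_bracket_compose:
  assumes "\<And>u v. ev R u v = ev P (ev A u v) (ev B u v)" "\<And>u v. ev R' u v = ev Q (ev A u v) (ev B u v)"
  shows "bracket A B dvd bracket R R'"
proof -
  obtain S C D where "\<And>u v. ev S u v = ev P (ev A u v) (ev B u v)"
    and S: "Dfst S = C * Dfst A + D * Dfst B" "pderiv S = C * pderiv A + D * pderiv B"
    using chain_rule by metis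
  then have "S = R" using assms(1) by (simp add: ev_eq_iff)
  obtain S' C' D' where "\<And>u v. ev S' u v = ev Q (ev A u v) (ev B u v)"
    and S': "Dfst S' = C' * Dfst A + D' * Dfst B" "pderiv S' = C' * pderiv A + D' * pderiv B"
    using chain_rule by metis
  then have "S' = R'" using assms(2) by (simp add: ev_eq_iff)
  have "bracket S S' = bracket A B * (C * D' - D * C')"
    by (simp add: bracket_def S S' algebra_simps)
  then show ?thesis using \<open>S = R\<close> \<open>S' = R'\<close> by (metis dvd_triv_left)
qed

section \<open>Top coefficients and the Wronskian\<close>

lemma coeff_mult_top:
  assumes "Polynomial.degree p \<le> i" "Polynomial.degree q \<le> j"
  shows "Polynomial.coeff (p * q) (i + j) = Polynomial.coeff p i * Polynomial.coeff q j"
proof -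
  have "Polynomial.coeff (p * q) (i + j) = (\<Sum>k\<le>i + j. Polynomial.coeff p k * Polynomial.coeff q (i + j - k))"
    by (rule coeff_mult)
  also have "\<dots> = (\<Sum>k\<in>{i}. Polynomial.coeff p k * Polynomial.coeff q (i + j - k))"
  proof (rule sum.mono_neutral_right)
    show "\<forall>k\<in>{..i + j} - {i}. Polynomial.coeff p k * Polynomial.coeff q (i + j - k) = 0"
    proof
      fix k assume k: "k \<in> {..i + j} - {i}"
      show "Polynomial.coeff p k * Polynomial.coeff q (i + j - k) = 0"
      proof (cases "k > i")
        case True
        then show ?thesis using assms(1) by (simp add: coeff_eq_0)
      next
        case False
        then have "i + j - k > Polynomial.degree q" using k assms(2) by auto
        then show ?thesis by (simp add: coeff_eq_0)
      qed
    qed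
  qed auto
  finally show ?thesis by simp
qed

text \<open>A divisor of t has degree at most 1 in t, which is below 2 d - 1 as d \<ge> 2. The
  coefficient of t^(2d - 1) in the bracket is d times the Wronskian of the top coefficients.\<close>

lemma top_coeffs_wronskian:
  assumes d: "d \<ge> 2" "Polynomial.degree F \<le> d" "Polynomial.degree G \<le> d"
    and dvd: "bracket F G dvd [:0, 1:]"
  shows "pderiv (Polynomial.coeff F d) * Polynomial.coeff G d = Polynomial.coeff F d * pderiv (Polynomial.coeff G d)"
proof -
  have Dfst_deg: "Polynomial.degree (Dfst P) \<le> d" if "Polynomial.degree P \<le> d" for P
    using that by (intro degree_le) (auto simp: Dfst_def coeff_map_poly coeff_eq_0)
  have pd_deg: "Polynomial.degree (pderiv P) \<le> d - 1" if "Polynomial.degree P \<le> d" for P :: "complex poly poly"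
    using that by (simp add: degree_pderiv)
  have cD: "Polynomial.coeff (Dfst P) k = pderiv (Polynomial.coeff P k)" for P k
    by (simp add: Dfst_def coeff_map_poly)
  have cd: "Polynomial.coeff (pderiv P) (d - 1) = of_nat d * Polynomial.coeff P d" for P :: "complex poly poly"
    using d(1) by (simp add: coeff_pderiv)
  have "Polynomial.degree (bracket F G) \<le> Polynomial.degree [:0, 1 :: complex poly:]"
    by (rule dvd_imp_degree_le[OF dvd]) simp
  then have "Polynomial.coeff (bracket F G) (d + (d - 1)) = 0"
    using d(1) by (intro coeff_eq_0) simp
  moreover have "Polynomial.coeff (Dfst F * pderiv G) (d + (d - 1)) = pderiv (Polynomial.coeff F d) * (of_nat d * Polynomial.coeff G d)"
    by (simp only: coeff_mult_top[OF Dfst_deg[OF d(2)] pd_deg[OF d(3)]] cD cd)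
  moreover have "Polynomial.coeff (pderiv F * Dfst G) ((d - 1) + d) = of_nat d * Polynomial.coeff F d * pderiv (Polynomial.coeff G d)"
    by (simp only: coeff_mult_top[OF pd_deg[OF d(2)] Dfst_deg[OF d(3)]] cD cd)
  ultimately have "of_nat d * (pderiv (Polynomial.coeff F d) * Polynomial.coeff G d) = of_nat d * (Polynomial.coeff F d * pderiv (Polynomial.coeff G d))"
    by (simp add: bracket_def add.commute mult_ac)
  moreover have "(of_nat d :: complex poly) \<noteq> 0" using d(1) by simp
  ultimately show ?thesis by (simp only: mult_cancel_left) simp
qed

text \<open>A zero Wronskian of nonzero polynomials forces equal degrees. The combination h that
  cancels the leading terms still has zero Wronskian with g; were it nonzero, it would have exactly
  the degree that the cancellation removes.\<close>

lemma wronskian_zero_dependent: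
  fixes f g :: "complex poly"
  assumes "pderiv f * g = f * pderiv g"
  shows "\<exists>a b. (a \<noteq> 0 \<or> b \<noteq> 0) \<and> Polynomial.smult a f + Polynomial.smult b g = 0"
proof -
  have deg: "Polynomial.degree f = Polynomial.degree g"
    if nz: "f \<noteq> 0" "g \<noteq> 0" and w: "pderiv f * g = f * pderiv g" for f g :: "complex poly"
  proof -
    have z: "pderiv f = 0 \<longleftrightarrow> Polynomial.degree f = 0" "pderiv g = 0 \<longleftrightarrow> Polynomial.degree g = 0"
      by (simp_all add: pderiv_eq_0_iff)
    show ?thesis
    proof (cases "Polynomial.degree f = 0 \<or> Polynomial.degree g = 0")
      case True
      then show ?thesis using z w nz by auto
    next
      case False
      have "Polynomial.lead_coeff (pderiv f * g) = Polynomial.lead_coeff (f * pderiv g)" using w by simp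
      then have "of_nat (Polynomial.degree f) * (Polynomial.lead_coeff f * Polynomial.lead_coeff g) =
          of_nat (Polynomial.degree g) * (Polynomial.lead_coeff f * Polynomial.lead_coeff g)"
        by (simp add: lead_coeff_mult degree_pderiv coeff_pderiv False del: of_nat_Suc of_nat_add)
           (use False in \<open>simp add: mult_ac\<close>)
      then have "of_nat (Polynomial.degree f) = (of_nat (Polynomial.degree g) :: complex)" using nz by simp
      then show ?thesis by simp
    qed
  qed
  show ?thesis
  proof (cases "f = 0 \<or> g = 0")
    case True
    then show ?thesis
    proof
      assume "f = 0" then show ?thesis by (intro exI[of _ 1] exI[of _ 0]) simp
    next
      assume "g = 0" then show ?thesis by (intro exI[of _ 0] exI[of _ 1]) simp
    qed
  next
    case False
    define a b where "a = Polynomial.lead_coeff g" and "b = - Polynomial.lead_coeff f"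
    define h where "h = Polynomial.smult a f + Polynomial.smult b g"
    have fg: "Polynomial.degree f = Polynomial.degree g" using deg assms False by blast
    have "h = 0"
    proof (rule ccontr)
      assume "h \<noteq> 0"
      have "pderiv h * g = h * pderiv g"
        using assms by (simp add: h_def pderiv_add pderiv_smult algebra_simps)
      then have "Polynomial.degree h = Polynomial.degree g" using deg \<open>h \<noteq> 0\<close> False by blast
      then have "Polynomial.lead_coeff h = 0" by (simp add: h_def a_def b_def fg)
      with \<open>h \<noteq> 0\<close> show False by simp
    qed
    moreover have "a \<noteq> 0" using False by (simp add: a_def)
    ultimately show ?thesis unfolding h_def by blast
  qed
qed

section \<open>Linearity of lifts\<close>

text \<open>The coordinate axes are excluded because the chart used below does not see the line \<open>v = 0\<close>;
  the complement of the axes is stable under the deck group.\<close>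

definition low_degree :: "nat \<Rightarrow> (complex \<times> complex \<Rightarrow> complex) \<Rightarrow> bool" where
  "low_degree d L \<longleftrightarrow>
     (\<forall>u v. u \<noteq> 0 \<longrightarrow> v \<noteq> 0 \<longrightarrow> (\<exists>q. Polynomial.degree q < d \<and> (\<forall>t. poly q t = L (t * u, t * v))))"

lemma low_degree_lincomb:
  assumes "low_degree d L" "low_degree d L'"
  shows "low_degree d (\<lambda>p. a * L p + b * L' p)"
  unfolding low_degree_def
proof (intro allI impI)
  fix u v :: complex assume "u \<noteq> 0" "v \<noteq> 0"
  then obtain q q' where "Polynomial.degree q < d" "\<And>t. poly q t = L (t * u, t * v)"
    "Polynomial.degree q' < d" "\<And>t. poly q' t = L' (t * u, t * v)"
    using assms unfolding low_degree_def by meson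
  then show "\<exists>q. Polynomial.degree q < d \<and> (\<forall>t. poly q t = a * L (t * u, t * v) + b * L' (t * u, t * v))"
    by (intro exI[of _ "Polynomial.smult a q + Polynomial.smult b q'"])
      (auto intro!: degree_add_less order.strict_trans1[OF degree_smult_le])
qed

lemma low_degree_cmult_cancel:
  assumes "low_degree d (\<lambda>p. a * L p)" "a \<noteq> 0"
  shows "low_degree d L"
  using low_degree_lincomb[OF assms(1,1), of "inverse a" 0] assms(2) by (simp flip: mult.assoc)

lemma low_degree_deck:
  assumes "low_degree d L" "\<gamma> \<in> decks n" "n \<ge> 3"
  shows "low_degree d (\<lambda>p. L (\<gamma> p))"
  unfolding low_degree_def
proof (intro allI impI)
  fix u v :: complex assume uv: "u \<noteq> 0" "v \<noteq> 0"
  obtain c where c: "c ^ (2 * (n - 2)) = 1" "\<gamma> = diag2 c \<or> \<gamma> = anti2 c"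
    using assms(2) by (auto simp: decks_def)
  have "c \<noteq> 0" using c(1) assms(3) by (auto simp: power_0_left)
  have "fst (\<gamma> (u, v)) \<noteq> 0" "snd (\<gamma> (u, v)) \<noteq> 0"
    using c(2) \<open>c \<noteq> 0\<close> uv by (auto simp: diag2_def anti2_def)
  moreover have "\<gamma> (t * u, t * v) = (t * fst (\<gamma> (u, v)), t * snd (\<gamma> (u, v)))" for t
    using c(2) by (auto simp: diag2_def anti2_def)
  ultimately show "\<exists>q. Polynomial.degree q < d \<and> (\<forall>t. poly q t = L (\<gamma> (t * u, t * v)))"
    using assms(1) unfolding low_degree_def by simp
qed

text \<open>In the chart \<open>u = s t\<close>, \<open>v = t\<close> the total degree becomes the degree in \<open>t\<close>.\<close>

lemma low_degree_iff:
  assumes F: "\<And>s t. ev F s t = ev U (s * t) t" and d: "Polynomial.degree F \<le> d" "d > 0"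
  shows "low_degree d (\<lambda>p. ev U (fst p) (snd p)) \<longleftrightarrow> Polynomial.coeff F d = 0"
proof
  assume low: "low_degree d (\<lambda>p. ev U (fst p) (snd p))"
  have "poly (Polynomial.coeff F d) s = 0" if "s \<noteq> 0" for s
  proof -
    have "\<exists>q. Polynomial.degree q < d \<and> (\<forall>t. poly q t = ev U (t * s) t)"
      using low[unfolded low_degree_def, rule_format, of s 1] that by simp
    then obtain q where q: "Polynomial.degree q < d" "\<And>t. poly q t = ev U (t * s) t" by blast
    have "poly q t = poly (map_poly (\<lambda>c. poly c s) F) t" for t
      by (simp add: q(2) F mult.commute flip: ev_map_poly)
    then have "q = map_poly (\<lambda>c. poly c s) F" by (simp add: poly_eq_poly_eq_iff fun_eq_iff flip: poly_eq_poly_eq_iff)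
    then have "poly (Polynomial.coeff F d) s = Polynomial.coeff q d" by (simp add: coeff_map_poly)
    then show ?thesis using q(1) by (simp add: coeff_eq_0)
  qed
  then show "Polynomial.coeff F d = 0"
    by (intro poly_eq_0_if_infinite_roots[OF infinite_nonzero_complex]) auto
next
  assume "Polynomial.coeff F d = 0"
  then have dF: "Polynomial.degree F < d"
    using d by (metis le_neq_implies_less leading_coeff_0_iff degree_0)
  show "low_degree d (\<lambda>p. ev U (fst p) (snd p))"
    unfolding low_degree_def
  proof (intro allI impI)
    fix u v :: complex assume uv: "u \<noteq> 0" "v \<noteq> 0"
    \<comment> \<open>On the line through (u, v) the chart coordinate s is the constant u / v, and
      the other coordinate is t v.\<close>
    define q where "q = pcompose (map_poly (\<lambda>c. poly c (u / v)) F) [:0, v:]"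
    have "Polynomial.degree (map_poly (\<lambda>c. poly c (u / v)) F) < d"
      using dF d(2) by (intro le_less_trans[OF degree_le dF]) (auto simp: coeff_map_poly coeff_eq_0)
    then have "Polynomial.degree q < d" using uv by (simp add: q_def degree_pcompose)
    moreover have "poly q t = ev U (t * u) (t * v)" for t
      using uv F[of "u / v" "t * v"] by (simp add: q_def poly_pcompose mult.commute flip: ev_map_poly)
    ultimately show "\<exists>q. Polynomial.degree q < d \<and> (\<forall>t. poly q t = ev U (fst (t * u, t * v)) (snd (t * u, t * v)))"
      by auto
  qed
qed

text \<open>Degree below 2 on a line through the origin and value 0 there give homogeneity of degree
  1 off the axes. The slice p(s) = U(s, 1) must then have degree at most 1, and U = v p(u /
  v).\<close>

lemma linear_if_low_degree:
  assumes low: "low_degree 2 (\<lambda>p. ev U (fst p) (snd p))" and zero: "ev U 0 0 = 0"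
  shows "\<exists>a b. \<forall>u v. ev U u v = a * u + b * v"
proof -
  have hom: "ev U (t * u) (t * v) = t * ev U u v" if uv: "u \<noteq> 0" "v \<noteq> 0" for t u v
  proof -
    have "\<exists>q. Polynomial.degree q < 2 \<and> (\<forall>t. poly q t = ev U (t * u) (t * v))"
      using low[unfolded low_degree_def, rule_format, OF uv] by simp
    then obtain q where q: "Polynomial.degree q < 2" "\<And>t. poly q t = ev U (t * u) (t * v)" by blast
    have "Polynomial.coeff q 0 = 0" using q(2)[of 0] zero by (simp add: poly_0_coeff_0)
    then obtain c where "q = [:0, c:]"
      using q(1) degree_le[of 1 q] by (intro that[of "Polynomial.coeff q 1"] poly_eqI)
        (auto simp: coeff_pCons coeff_eq_0 split: nat.splits)
    then have "poly q t = t * poly q 1" by simp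
    then show ?thesis by (simp add: q(2))
  qed
  obtain p where p: "\<And>s. poly p s = ev U s 1"
    by (metis ev_def)
  obtain h where h: "\<And>v. poly h v = ev U 1 v"
    using ev_map_poly by metis
  define m where "m = Polynomial.degree p"
  have "m \<le> 1"
  proof (rule ccontr)
    assume "\<not> m \<le> 1"
    \<comment> \<open>Homogeneity reads h(v) = v p(1 / v), so the reversed polynomial v^m p(1 / v)
      is v^(m - 1) h(v). Its constant coefficient is the leading coefficient of p, yet it vanishes
      for m > 1.\<close>
    have "poly (reflect_poly p - Polynomial.monom 1 (m - 1) * h) v = 0" if "v \<noteq> 0" for v
    proof -
      have "ev U 1 v = v * ev U (inverse v) 1"
        using hom[of "inverse v" 1 v] that by simp
      moreover have "v ^ m = v ^ (m - 1) * v" using \<open>\<not> m \<le> 1\<close> by (metis power_minus_mult not_less_zero linorder_not_le less_one order.strict_trans2 zero_less_one)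
      ultimately show ?thesis
        using that by (simp add: poly_reflect_poly_nz p h poly_monom m_def[symmetric])
    qed
    then have "reflect_poly p - Polynomial.monom 1 (m - 1) * h = 0"
      by (intro poly_eq_0_if_infinite_roots[OF infinite_nonzero_complex]) auto
    then have "Polynomial.coeff (reflect_poly p) 0 = Polynomial.coeff (Polynomial.monom 1 (m - 1) * h) 0" by simp
    then have "Polynomial.lead_coeff p = 0" using \<open>\<not> m \<le> 1\<close> by (simp add: coeff_mult)
    then have "p = 0" by simp
    then show False using \<open>\<not> m \<le> 1\<close> by (simp add: m_def)
  qed
  define a b where "a = Polynomial.coeff p 1" and "b = Polynomial.coeff p 0"
  have "p = [:b, a:]"
    using \<open>m \<le> 1\<close> unfolding a_def b_def m_def
    by (intro poly_eqI) (auto simp: coeff_pCons coeff_eq_0 split: nat.splits)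
  have "U = [:[:a:]:] * [:[:0, 1:]:] + [:[:b:]:] * [:0, 1:]"
  proof (rule ev_eqI)
    fix u v :: complex assume uv: "u \<noteq> 0" "v \<noteq> 0"
    have "ev U u v = v * ev U (u / v) 1" using hom[of "u / v" 1 v] uv by simp
    also have "ev U (u / v) 1 = poly p (u / v)" by (simp only: p)
    also have "\<dots> = b + u / v * a" by (subst \<open>p = [:b, a:]\<close>) simp
    also have "v * \<dots> = a * u + b * v" using uv by (simp add: distrib_left mult.commute)
    finally show "ev U u v = ev ([:[:a:]:] * [:[:0, 1:]:] + [:[:b:]:] * [:0, 1:]) u v" by simp
  qed
  then have "\<forall>u v. ev U u v = a * u + b * v" by (simp add: ev_eq_iff)
  then show ?thesis by blast
qed

text \<open>The condition on \<open>z\<^sup>2\<close> makes z and its inverse distinct eigenvalues.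
  For n \<ge> 5 there are more than four roots of unity, so z can also avoid order 4, the order of
  the antidiagonal deck transformations; for n = 4 only \<i> and - \<i> remain.\<close>

lemma ex_root_of_unity:
  assumes "n \<ge> 4"
  shows "\<exists>z :: complex. z ^ (2 * (n - 2)) = 1 \<and> z\<^sup>2 \<noteq> 1 \<and> (n \<ge> 5 \<longrightarrow> z\<^sup>2 \<noteq> - 1)"
proof (cases "n = 4")
  case True
  then show ?thesis by (intro exI[of _ \<i>]) (simp add: power2_eq_square numeral_eq_Suc)
next
  case False
  have "card {z :: complex. z ^ 4 = 1} < card {z :: complex. z ^ (2 * (n - 2)) = 1}"
    using False assms by (simp add: card_roots_unity_eq)
  moreover have "finite {z :: complex. z ^ 4 = 1}" by (rule card_ge_0_finite) (simp add: card_roots_unity_eq)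
  ultimately obtain z :: complex where z: "z ^ (2 * (n - 2)) = 1" "z ^ 4 \<noteq> 1"
    by (metis (mono_tags, lifting) card_mono linorder_not_le mem_Collect_eq subsetI)
  have "z ^ 4 = (z\<^sup>2)\<^sup>2" by (simp flip: power_mult)
  then have "z\<^sup>2 \<noteq> 1" "z\<^sup>2 \<noteq> - 1" using z(2) by (metis one_power2, metis one_power2 power2_minus)
  with z(1) show ?thesis by blast
qed

text \<open>Deck transformations have determinant 1, and the chart (s t, t) has Jacobian t.\<close>

lemma bracket_chart_deck:
  assumes "\<delta> \<in> decks n" "n \<ge> 3"
    and "\<And>s t. (ev R s t, ev R' s t) = \<delta> (s * t, t)"
  shows "bracket R R' = [:0, 1:]"
proof -
  obtain c where c: "c ^ (2 * (n - 2)) = 1" "\<delta> = diag2 c \<or> \<delta> = anti2 c"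
    using assms(1) by (auto simp: decks_def)
  have "c \<noteq> 0" using c(1) assms(2) by (auto simp: power_0_left)
  from c(2) show ?thesis
  proof
    assume "\<delta> = diag2 c"
    then have "ev R s t = c * (s * t)" "ev R' s t = inverse c * t" for s t
      using assms(3)[of s t] by (simp_all add: diag2_def)
    then have R: "R = [:0, [:0, c:]:]" "R' = [:0, [:inverse c:]:]" by (simp_all add: ev_eq_iff mult_ac)
    show ?thesis unfolding R using \<open>c \<noteq> 0\<close> by (simp add: bracket_def pderiv_pCons)
  next
    assume "\<delta> = anti2 c"
    then have "ev R s t = c * t" "ev R' s t = - inverse c * (s * t)" for s t
      using assms(3)[of s t] by (simp_all add: anti2_def)
    then have R: "R = [:0, [:c:]:]" "R' = [:0, [:0, - inverse c:]:]" by (simp_all add: ev_eq_iff mult_ac)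
    show ?thesis unfolding R using \<open>c \<noteq> 0\<close> by (simp add: bracket_def pderiv_pCons)
  qed
qed

lemma lift_linear:
  assumes n: "n \<ge> 4" and "polymap2 \<Phi>" "polymap2 \<Psi>"
    and \<Psi>\<Phi>: "\<And>p. \<Psi> (\<Phi> p) = \<delta>0 p" "\<delta>0 \<in> decks n"
    and equiv: "\<And>\<delta>. \<delta> \<in> decks n \<Longrightarrow> \<exists>\<gamma>\<in>decks n. \<forall>p. \<delta> (\<Phi> p) = \<Phi> (\<gamma> p)"
  shows "\<exists>a b c d. \<forall>u v. \<Phi> (u, v) = (a * u + b * v, c * u + d * v)"
proof -
  obtain U V where U: "\<And>u v. \<Phi> (u, v) = (ev U u v, ev V u v)"
    using assms(2) unfolding polymap2_def by blast
  obtain P Q where P: "\<And>u v. \<Psi> (u, v) = (ev P u v, ev Q u v)"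
    using assms(3) unfolding polymap2_def by blast
  have chart: "\<exists>F. \<forall>s t. ev F s t = ev W (s * t) t" for W
    using ev_compose[of W "[:0, [:0, 1:]:]" "[:0, 1:]"] by (simp add: mult.commute)
  obtain F where F: "\<And>s t. ev F s t = ev U (s * t) t" using chart by blast
  obtain G where G: "\<And>s t. ev G s t = ev V (s * t) t" using chart by blast
  let ?U = "\<lambda>p. ev U (fst p) (snd p)" and ?V = "\<lambda>p. ev V (fst p) (snd p)"
  have UV: "?U p = fst (\<Phi> p)" "?V p = snd (\<Phi> p)" for p
    by (cases p, simp add: U)+
  obtain z :: complex where z: "z ^ (2 * (n - 2)) = 1" "z\<^sup>2 \<noteq> 1"
    using ex_root_of_unity[OF n] by blast
  have "z \<noteq> 0" using z(1) n by (auto simp: power_0_left)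
  have zz: "z - inverse z \<noteq> 0" "z \<noteq> 1" "inverse z \<noteq> 1" using z(2) \<open>z \<noteq> 0\<close> by (auto simp: field_simps power2_eq_square)
  have mem: "diag2 z \<in> decks n" "anti2 1 \<in> decks n" using z(1) by (auto simp: decks_def)
  obtain \<gamma> where \<gamma>: "\<gamma> \<in> decks n" "\<And>p. diag2 z (\<Phi> p) = \<Phi> (\<gamma> p)" using equiv[OF mem(1)] by blast
  obtain \<sigma> where \<sigma>: "\<sigma> \<in> decks n" "\<And>p. anti2 1 (\<Phi> p) = \<Phi> (\<sigma> p)" using equiv[OF mem(2)] by blast
  have \<gamma>UV: "?U (\<gamma> p) = z * ?U p" "?V (\<gamma> p) = inverse z * ?V p" for p
    by (simp_all only: UV flip: \<gamma>(2)) (simp_all add: diag2_def)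
  have \<sigma>UV: "?U (\<sigma> p) = ?V p" "?V (\<sigma> p) = - ?U p" for p
    by (simp_all only: UV flip: \<sigma>(2)) (simp_all add: anti2_def)
  have dvd: "bracket F G dvd [:0, 1:]"
  proof -
    obtain R where R: "\<And>s t. ev R s t = ev P (ev F s t) (ev G s t)" using ev_compose by metis
    obtain R' where R': "\<And>s t. ev R' s t = ev Q (ev F s t) (ev G s t)" using ev_compose by metis
    have "(ev R s t, ev R' s t) = \<delta>0 (s * t, t)" for s t
      by (simp add: R R' F G flip: P U \<Psi>\<Phi>(1))
    then have "bracket R R' = [:0, 1:]" using bracket_chart_deck[OF \<Psi>\<Phi>(2)] n by simp
    then show ?thesis using bracket_dvd_bracket_compose[OF R R'] by simp
  qed
  define d where "d = max (Polynomial.degree F) (Polynomial.degree G)"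
  have "d < 2"
  proof (rule ccontr)
    assume "\<not> d < 2"
    then have d: "d \<ge> 2" "Polynomial.degree F \<le> d" "Polynomial.degree G \<le> d"
      unfolding d_def by linarith+
    obtain a b where ab: "a \<noteq> 0 \<or> b \<noteq> 0"
      "Polynomial.smult a (Polynomial.coeff F d) + Polynomial.smult b (Polynomial.coeff G d) = 0"
      using wronskian_zero_dependent[OF top_coeffs_wronskian[OF d dvd]] by (elim exE conjE)
    have lowF: "low_degree d ?U \<longleftrightarrow> Polynomial.coeff F d = 0" using low_degree_iff[OF F d(2)] d(1) by simp
    have lowG: "low_degree d ?V \<longleftrightarrow> Polynomial.coeff G d = 0" using low_degree_iff[OF G d(3)] d(1) by simp
    define W where "W = [:[:a:]:] * U + [:[:b:]:] * V"
    define H where "H = [:[:a:]:] * F + [:[:b:]:] * G"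
    have "Polynomial.coeff H d = 0" using ab(2) by (simp add: H_def)
    moreover have "Polynomial.degree H \<le> d"
      unfolding H_def using d by (intro degree_add_le) (auto intro!: order.trans[OF degree_smult_le])
    moreover have "ev H s t = ev W (s * t) t" for s t by (simp add: H_def W_def F G)
    ultimately have "low_degree d (\<lambda>p. ev W (fst p) (snd p))" using low_degree_iff[of H W d] d(1) by simp
    then have L: "low_degree d (\<lambda>p. a * ?U p + b * ?V p)" by (simp add: W_def)
    have L\<gamma>: "low_degree d (\<lambda>p. a * (z * ?U p) + b * (inverse z * ?V p))"
      using low_degree_deck[OF L \<gamma>(1)] n by (simp add: \<gamma>UV)
    \<comment> \<open>The conjugate of \<open>diag2 z\<close> turns a U + b V into a z U + b V / z.
      Since z differs from its inverse, combining the two isolates each term: a line spanned by a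
      combination of U and V modulo lower degree must be a coordinate line.\<close>
    have "1 * (a * (z * x) + b * (inverse z * y)) + - inverse z * (a * x + b * y) = (a * (z - inverse z)) * x"
      "z * (a * x + b * y) + - 1 * (a * (z * x) + b * (inverse z * y)) = (b * (z - inverse z)) * y" for x y
      by (simp_all add: algebra_simps)
    then have "low_degree d (\<lambda>p. (a * (z - inverse z)) * ?U p)" "low_degree d (\<lambda>p. (b * (z - inverse z)) * ?V p)"
      using low_degree_lincomb[OF L\<gamma> L, of 1 "- inverse z"] low_degree_lincomb[OF L L\<gamma>, of z "- 1"]
      by (simp_all only:)
    from low_degree_cmult_cancel[OF this(1)] low_degree_cmult_cancel[OF this(2)]
    have "a \<noteq> 0 \<Longrightarrow> low_degree d ?U" "b \<noteq> 0 \<Longrightarrow> low_degree d ?V"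
      using zz(1) by simp_all
    then have "low_degree d ?U \<or> low_degree d ?V" using ab(1) by blast
    \<comment> \<open>The conjugate of \<open>anti2 1\<close> exchanges U and V up to sign, so
      neither can drop in degree alone; a drop of both contradicts the choice of d.\<close>
    moreover have "low_degree d ?V" if "low_degree d ?U"
      using low_degree_deck[OF that \<sigma>(1)] n by (simp add: \<sigma>UV)
    moreover have "low_degree d ?U" if "low_degree d ?V"
    proof -
      have "low_degree d (\<lambda>p. - 1 * ?U p)" using low_degree_deck[OF that \<sigma>(1)] n by (simp add: \<sigma>UV)
      then show ?thesis by (rule low_degree_cmult_cancel) simp
    qed
    ultimately have "Polynomial.coeff F d = 0" "Polynomial.coeff G d = 0" using lowF lowG by blast+
    moreover have "d = Polynomial.degree F \<or> d = Polynomial.degree G" by (auto simp: d_def)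
    ultimately have "F = 0 \<and> d = 0 \<or> G = 0 \<and> d = 0" by auto
    then show False using d(1) by simp
  qed
  then have d: "Polynomial.degree F < 2" "Polynomial.degree G < 2" by (auto simp: d_def)
  have low: "low_degree 2 ?U" "low_degree 2 ?V"
    using low_degree_iff[OF F, of 2] low_degree_iff[OF G, of 2] d by (simp_all add: coeff_eq_0)
  \<comment> \<open>Equivariance at the origin reads U(0, 0) = z U(0, 0) and V(0, 0) = V(0, 0) / z,
    which forces both values to be 0.\<close>
  have \<gamma>0: "\<gamma> (0, 0) = (0, 0)" using \<gamma>(1) by (auto simp: decks_def diag2_def anti2_def)
  have "ev U 0 0 = 0" "ev V 0 0 = 0"
    using \<gamma>UV[of "(0, 0)"] zz(2,3) by (simp_all add: \<gamma>0)
  then obtain a b c d where "\<forall>u v. ev U u v = a * u + b * v" "\<forall>u v. ev V u v = c * u + d * v"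
    using linear_if_low_degree[OF low(1)] linear_if_low_degree[OF low(2)] by blast
  then show ?thesis using U by auto
qed

section \<open>Classification of automorphisms\<close>

lemma sign_quotient:
  fixes A B :: complex
  assumes "A\<^sup>2 = B\<^sup>2"
  shows "\<exists>s\<in>{1, -1}. A = s * B"
proof -
  from assms have "A = B \<or> A = - B" by (simp add: power2_eq_iff)
  then show ?thesis by auto
qed

text \<open>With \<lambda> = a d, the coordinates x, y, z are scaled by \<lambda>^2, a^N and
  \<lambda> a^N for N = 2 (n - 2). As a^N is s \<lambda>^(n - 2), the same sign s appears
  twice.\<close>

lemma cover_diag:
  assumes n: "n \<ge> 3" and "a ^ (2 * (n - 2)) = s * (a * d) ^ (n - 2)" "d ^ (2 * (n - 2)) = a ^ (2 * (n - 2))"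
  shows "cover n (a * u) (d * v) = diag_map n (a * d) s s (cover n u v)"
proof -
  have "n - 1 = Suc (n - 2)" using n by simp
  then show ?thesis using assms(2,3)
    by (simp add: cover_def diag_map_def power_mult_distrib[of _ _ "2 * (n - 2)"] del: power_Suc power_mult_numeral)
       (simp add: power_mult_distrib algebra_simps)
qed

text \<open>Exchanging u and v fixes x and y and negates z; this is the source of opposite
  signs.\<close>

lemma cover_anti:
  assumes n: "n \<ge> 3" and "b ^ (2 * (n - 2)) = s * (b * c) ^ (n - 2)" "c ^ (2 * (n - 2)) = b ^ (2 * (n - 2))"
  shows "cover n (b * v) (c * u) = diag_map n (b * c) s (- s) (cover n u v)"
proof -
  have "cover n (b * v) (c * u) = diag_map n (b * c) s s (cover n v u)"
    using cover_diag[OF assms] .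
  also have "\<dots> = diag_map n (b * c) s (- s) (cover n u v)"
    by (simp add: cover_def diag_map_def algebra_simps)
  finally show ?thesis .
qed

definition regular_inverses :: "point3 set \<Rightarrow> (point3 \<Rightarrow> point3) \<Rightarrow> (point3 \<Rightarrow> point3) \<Rightarrow> bool" where
  "regular_inverses S f g \<longleftrightarrow> regular_map3 S f \<and> f \<in> S \<rightarrow> S \<and> regular_map3 S g \<and> g \<in> S \<rightarrow> S \<and>
     (\<forall>p\<in>S. g (f p) = p) \<and> (\<forall>p\<in>S. f (g p) = p)"

text \<open>For n = 4 the exceptional alternative records only the first coordinate: x + \<i> y and
  x - \<i> y are the other linear factors of x^3 + x y^2, and composing with a power of
  \<open>tau\<close> turns them back into multiples of x, which returns to the diagonal
  case.\<close>

lemma automorphism_cases: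
  assumes n: "n \<ge> 4" and fg_inv: "regular_inverses (klein_surface_D n) f g"
  shows "(\<exists>h\<in>klein_G n. \<forall>p\<in>klein_surface_D n. f p = h p) \<or>
    n = 4 \<and> (\<exists>k. \<exists>e\<in>{1, -1}. \<forall>p\<in>klein_surface_D n. fst (f p) = k * (fst p + e * \<i> * fst (snd p)))"
proof -
  have f: "regular_map3 (klein_surface_D n) f" "f \<in> klein_surface_D n \<rightarrow> klein_surface_D n"
    and g: "regular_map3 (klein_surface_D n) g" "g \<in> klein_surface_D n \<rightarrow> klein_surface_D n"
    and gf: "\<And>p. p \<in> klein_surface_D n \<Longrightarrow> g (f p) = p" and fg: "\<And>p. p \<in> klein_surface_D n \<Longrightarrow> f (g p) = p"
    using fg_inv by (simp_all add: regular_inverses_def)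
  define N where "N = 2 * (n - 2)"
  have N: "N > 0" "even N" using n by (simp_all add: N_def)
  have n3: "n \<ge> 3" and n2: "n \<ge> 2" using n by simp_all
  note S = cover_in_surface[OF n2]
  obtain \<Phi> p0 where \<Phi>: "polymap2 \<Phi>" "fst (\<Phi> p0) * snd (\<Phi> p0) \<noteq> 0" "\<And>p. cov n (\<Phi> p) = f (cov n p)"
    using automorphism_lift[OF n3 f g(1) gf] by blast
  obtain \<Psi> where \<Psi>: "polymap2 \<Psi>" "\<And>p. cov n (\<Psi> p) = g (cov n p)"
    using automorphism_lift[OF n3 g f(1) fg] by blast
  have id: "polymap2 (\<lambda>p. p)"
    unfolding polymap2_def by (intro exI[of _ "[:[:0, 1:]:]"] exI[of _ "[:0, 1:]"]) simp
  have nz: "fst (1, 1) * snd (1 :: complex, 1 :: complex) \<noteq> 0" by simp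
  have "cov n (\<Psi> (\<Phi> p)) = cov n p" for p by (simp only: \<Phi>(3) \<Psi>(2) gf[OF S])
  from lift_unique[OF n3 id polymap2_comp[OF \<Psi>(1) \<Phi>(1)] nz this]
  obtain \<delta>0 where \<delta>0: "\<delta>0 \<in> decks n" "\<And>p. \<Psi> (\<Phi> p) = \<delta>0 p" by blast
  have equiv: "\<exists>\<gamma>\<in>decks n. \<forall>p. \<delta> (\<Phi> p) = \<Phi> (\<gamma> p)" if "\<delta> \<in> decks n" for \<delta>
    using lift_equivariant[OF n3 \<Phi>(1,3) \<Psi> gf[OF S] fg[OF S] that] .
  obtain a b c d where L: "\<And>u v. \<Phi> (u, v) = (a * u + b * v, c * u + d * v)"
    using lift_linear[OF n \<Phi>(1) \<Psi>(1) \<delta>0(2,1) equiv] by blast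
  have cov\<Phi>: "f (cover n u v) = cover n (a * u + b * v) (c * u + d * v)" for u v
    using \<Phi>(3)[of "(u, v)"] by (simp add: L)
  have "inj \<delta>0"
  proof -
    obtain e where e: "e ^ N = 1" "\<delta>0 = diag2 e \<or> \<delta>0 = anti2 e"
      using \<delta>0(1) by (auto simp: decks_def N_def)
    then have "e \<noteq> 0" using N by (auto simp: power_0_left)
    then show ?thesis using e(2) by (auto simp: inj_def diag2_def anti2_def prod_eq_iff)
  qed
  then have inj: "\<Phi> p = \<Phi> q \<Longrightarrow> p = q" for p q
    by (metis \<delta>0(2) injD)
  have det: "a * d - b * c \<noteq> 0"
  proof
    assume det: "a * d - b * c = 0"
    then have "\<Phi> (d, - c) = \<Phi> (0, 0)" "\<Phi> (- b, a) = \<Phi> (0, 0)" by (simp_all add: L algebra_simps)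
    from inj[OF this(1)] inj[OF this(2)] have "a = 0" "b = 0" "c = 0" "d = 0" by simp_all
    then have "\<Phi> (1, 1) = \<Phi> (0, 0)" by (simp add: L)
    from inj[OF this] show False by simp
  qed
  \<comment> \<open>The points (1, 0) and (0, 1) lie in one fibre, and the lift maps them to the
    columns of its matrix.\<close>
  have swap: "cover n b d = cover n a c"
  proof -
    have "anti2 1 \<in> decks n" by (auto simp: decks_def)
    from cov_decks[OF this n3, of "(0, 1)"] have "cover n 1 0 = cover n 0 1"
      by (simp add: anti2_def)
    then show ?thesis using cov\<Phi>[of 1 0] cov\<Phi>[of 0 1] by simp
  qed
  obtain z :: complex where z: "z ^ N = 1" "z\<^sup>2 \<noteq> 1" "n \<ge> 5 \<Longrightarrow> z\<^sup>2 \<noteq> - 1"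
    using ex_root_of_unity[OF n] by (auto simp: N_def)
  have "z \<noteq> 0" using z(1) N by (auto simp: power_0_left)
  have mem: "diag2 z \<in> decks n" using z(1) by (auto simp: decks_def N_def)
  have "polymap2 (\<lambda>p. \<Phi> (diag2 z p))" by (rule polymap2_comp[OF \<Phi>(1) polymap2_decks[OF mem]])
  moreover have "cov n (\<Phi> (diag2 z p)) = cov n (\<Phi> p)" for p
    by (simp only: \<Phi>(3) cov_decks[OF mem n3])
  ultimately obtain \<delta> where \<delta>: "\<delta> \<in> decks n" "\<And>p. \<Phi> (diag2 z p) = \<delta> (\<Phi> p)"
    using lift_unique[OF n3 \<Phi>(1) _ \<Phi>(2)] by blast
  obtain e where e: "e ^ N = 1" "\<delta> = diag2 e \<or> \<delta> = anti2 e"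
    using \<delta>(1) by (auto simp: decks_def N_def)
  then have "e \<noteq> 0" using N by (auto simp: power_0_left)
  note \<delta>1 = \<delta>(2)[of "(1, 0)"] and \<delta>2 = \<delta>(2)[of "(0, 1)"]
  have sign: "\<exists>s\<in>{1, -1}. a ^ N = s * (a * d) ^ (n - 2)" if "d ^ N = a ^ N" for a d :: complex
  proof (rule sign_quotient)
    have "(a ^ N)\<^sup>2 = (a * d) ^ N" using that by (simp add: power_mult_distrib power2_eq_square)
    then show "(a ^ N)\<^sup>2 = ((a * d) ^ (n - 2))\<^sup>2" by (simp add: N_def mult.commute flip: power_mult)
  qed
  from e(2) show ?thesis
  proof
    assume "\<delta> = diag2 e"
    \<comment> \<open>The columns are eigenvectors of diag(e, 1 / e) for the distinct eigenvalues z
      and 1 / z, so they lie on different axes.\<close>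
    then have eqs: "a * z = e * a" "c * z = inverse e * c" "b * inverse z = e * b" "d * inverse z = inverse e * d"
      using \<delta>1 \<delta>2 by (simp_all add: diag2_def L)
    have "b = 0 \<and> c = 0 \<or> a = 0 \<and> d = 0"
    proof (cases "a = 0")
      case False
      then have "e = z" using eqs(1) by simp
      with eqs(2,3) z(2) \<open>z \<noteq> 0\<close> show ?thesis by (auto simp: field_simps power2_eq_square)
    next
      case True
      then have "b \<noteq> 0" using det by auto
      then have "e = inverse z" using eqs(3) by simp
      with eqs(4) z(2) \<open>z \<noteq> 0\<close> True show ?thesis by (auto simp: field_simps power2_eq_square)
    qed
    then show ?thesis
    proof
      assume bc: "b = 0 \<and> c = 0"
      then have "d ^ N = a ^ N" using swap N by (simp add: cover_def power_0_left flip: N_def)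
      then obtain s where s: "s \<in> {1, -1}" "a ^ N = s * (a * d) ^ (n - 2)" using sign by blast
      have "f p = diag_map n (a * d) s s p" if "p \<in> klein_surface_D n" for p
      proof -
        obtain u v where "p = cover n u v" using cover_surj[OF n3 \<open>p \<in> _\<close>] by blast
        then show ?thesis
          using cov\<Phi>[of u v] cover_diag[OF n3, of a s d u v] s(2) \<open>d ^ N = a ^ N\<close> bc by (simp add: N_def)
      qed
      moreover have "a * d \<noteq> 0" using det bc by simp
      ultimately show ?thesis using s(1) unfolding klein_G_def by blast
    next
      assume ad: "a = 0 \<and> d = 0"
      then have "c ^ N = b ^ N" using swap N by (simp add: cover_def power_0_left flip: N_def)
      then obtain s where s: "s \<in> {1, -1}" "b ^ N = s * (b * c) ^ (n - 2)" using sign by blast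
      have "f p = diag_map n (b * c) s (- s) p" if "p \<in> klein_surface_D n" for p
      proof -
        obtain u v where "p = cover n u v" using cover_surj[OF n3 \<open>p \<in> _\<close>] by blast
        then show ?thesis
          using cov\<Phi>[of u v] cover_anti[OF n3, of b s c v u] s(2) \<open>c ^ N = b ^ N\<close> ad by (simp add: N_def)
      qed
      moreover have "b * c \<noteq> 0" "- s \<in> {1, -1}" using det ad s(1) by auto
      ultimately show ?thesis using s(1) unfolding klein_G_def by blast
    qed
  next
    assume "\<delta> = anti2 e"
    then have eqs: "a * z = e * c" "c * z = - inverse e * a" "b * inverse z = e * d" "d * inverse z = - inverse e * b"
      using \<delta>1 \<delta>2 by (simp_all add: anti2_def diag2_def L)
    have c: "c = a * z / e" and d: "d = b / (z * e)"
      using eqs(1,3) \<open>e \<noteq> 0\<close> \<open>z \<noteq> 0\<close> by (simp_all add: field_simps)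
    have "a \<noteq> 0" "b \<noteq> 0" using det by (auto simp: c d)
    \<comment> \<open>An antidiagonal deck transformation squares to - 1, so its eigenvalue z does
      too; the choice of z then leaves only n = 4.\<close>
    have "a * z\<^sup>2 = a * (- 1)"
      using eqs(2) \<open>e \<noteq> 0\<close> by (simp add: c field_simps power2_eq_square)
    then have z2: "z\<^sup>2 = - 1" using \<open>a \<noteq> 0\<close> by (simp only: mult_cancel_left) simp
    then have "n = 4" using z(3) n by (cases "n \<ge> 5") auto
    have "inverse z = - z"
    proof -
      have "z * (- z) = 1" using z2 by (simp add: power2_eq_square)
      then show ?thesis by (rule inverse_unique)
    qed
    then have d': "d = - (z / e) * b" unfolding d by (simp add: divide_inverse)
    have ze: "(z / e)\<^sup>2 = - inverse (e\<^sup>2)" 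
      by (simp only: power_divide z2) (simp add: divide_inverse)
    have "b\<^sup>2 * d\<^sup>2 = a\<^sup>2 * c\<^sup>2" using swap by (simp add: cover_def)
    then have "(z / e)\<^sup>2 * (b\<^sup>2)\<^sup>2 = (z / e)\<^sup>2 * (a\<^sup>2)\<^sup>2"
      by (simp add: c d' power2_eq_square mult_ac)
    then have "(b\<^sup>2)\<^sup>2 = (a\<^sup>2)\<^sup>2" using \<open>z \<noteq> 0\<close> \<open>e \<noteq> 0\<close> by simp
    then obtain r where r: "r \<in> {1, -1}" "b\<^sup>2 = r * a\<^sup>2" using sign_quotient by blast
    then have rr: "r * r = 1" by auto
    have "fst (f p) = (2 * (a\<^sup>2)\<^sup>2 * r * inverse (e\<^sup>2)) * (fst p + r * \<i> * fst (snd p))" if "p \<in> klein_surface_D n" for p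
    proof -
      obtain u v where p: "p = cover n u v" using cover_surj[OF n3 \<open>p \<in> _\<close>] by blast
      have "fst (f p) = ((a * u + b * v) * (c * u + d * v))\<^sup>2"
        unfolding p cov\<Phi> by (simp add: cover_def power_mult_distrib)
      also have "c * u + d * v = (z / e) * (a * u - b * v)" by (simp add: c d' algebra_simps)
      also have "(a * u + b * v) * ((z / e) * (a * u - b * v)) = (z / e) * (a\<^sup>2 * u\<^sup>2 - b\<^sup>2 * v\<^sup>2)"
        by (simp add: algebra_simps power2_eq_square add_divide_distrib)
      also have "\<dots> = (z / e) * a\<^sup>2 * (u\<^sup>2 - r * v\<^sup>2)" by (simp add: r(2) algebra_simps)
      also have "(\<dots>)\<^sup>2 = (z / e)\<^sup>2 * (a\<^sup>2)\<^sup>2 * (u\<^sup>2 - r * v\<^sup>2)\<^sup>2" by (simp only: power_mult_distrib)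
      \<comment> \<open>For n = 4 the coordinate y is \<i> / 2 times u^4 + v^4, so this square is -
        2 r (x + r \<i> y); the factor r r = 1 is inserted to pull out r.\<close>
      also have "(u\<^sup>2 - r * v\<^sup>2)\<^sup>2 = u ^ 4 + (r * r) * v ^ 4 - 2 * r * (u\<^sup>2 * v\<^sup>2)"
        by (simp add: power2_eq_square power4_eq_xxxx algebra_simps)
      also have "\<dots> = (r * r) * u ^ 4 + (r * r) * v ^ 4 - 2 * r * (u\<^sup>2 * v\<^sup>2)"
        by (simp add: rr)
      also have "\<dots> = - (2 * r * (u\<^sup>2 * v\<^sup>2 + r * \<i> * (\<i> / 2 * (u ^ 4 + v ^ 4))))"
        by (simp add: algebra_simps)
      finally show ?thesis
        by (simp add: p cover_def \<open>n = 4\<close> ze)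
    qed
    then show ?thesis using \<open>n = 4\<close> r(1) by blast
  qed
qed

section \<open>The diagonal group\<close>

lemma regular_inverses_compose:
  assumes "regular_inverses S f g" "regular_inverses S h k"
  shows "regular_inverses S (compose S f h) (compose S k g)"
  using assms unfolding regular_inverses_def
  by (auto intro!: regular_map3_compose simp: compose_eq Pi_iff)

lemma mult_BijGroup [simp]: "f \<in> Bij S \<Longrightarrow> g \<in> Bij S \<Longrightarrow> f \<otimes>\<^bsub>BijGroup S\<^esub> g = compose S f g"
  by (simp add: BijGroup_def)

lemma one_BijGroup: "\<one>\<^bsub>BijGroup S\<^esub> = (\<lambda>x\<in>S. x)"
  by (simp add: BijGroup_def)

lemma carrier_BijGroup: "carrier (BijGroup S) = Bij S"
  by (simp add: BijGroup_def)

lemma restrict_in_Bij: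
  assumes "f \<in> S \<rightarrow> S" "g \<in> S \<rightarrow> S" "\<And>p. p \<in> S \<Longrightarrow> g (f p) = p" "\<And>p. p \<in> S \<Longrightarrow> f (g p) = p"
  shows "restrict f S \<in> Bij S" "inv\<^bsub>BijGroup S\<^esub> (restrict f S) = restrict g S"
proof -
  have bij: "bij_betw (restrict f S) S S" if "f \<in> S \<rightarrow> S" "g \<in> S \<rightarrow> S"
    "\<And>p. p \<in> S \<Longrightarrow> g (f p) = p" "\<And>p. p \<in> S \<Longrightarrow> f (g p) = p" for f g
    using that by (intro bij_betw_byWitness[where f' = g]) auto
  then have B: "restrict f S \<in> Bij S" "restrict g S \<in> Bij S"
    using assms bij[OF assms] bij[OF assms(2,1,4,3)] by (simp_all add: Bij_def)
  show "restrict f S \<in> Bij S" by fact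
  interpret group "BijGroup S" by (rule group_BijGroup)
  show "inv\<^bsub>BijGroup S\<^esub> (restrict f S) = restrict g S"
    using B assms(1,3) by (intro inv_equality)
      (auto simp: carrier_BijGroup one_BijGroup compose_def fun_eq_iff Pi_iff)
qed

lemma variety_AutI:
  assumes "regular_inverses S (restrict f S) (restrict g S)"
  shows "restrict f S \<in> variety_Aut S"
proof -
  have maps: "f \<in> S \<rightarrow> S" "g \<in> S \<rightarrow> S" "\<And>p. p \<in> S \<Longrightarrow> g (f p) = p" "\<And>p. p \<in> S \<Longrightarrow> f (g p) = p"
    using assms by (auto simp: regular_inverses_def Pi_iff)
  show ?thesis
    using restrict_in_Bij[OF maps] assms by (simp add: variety_Aut_def carrier_BijGroup regular_inverses_def)
qed

lemma variety_AutE: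
  assumes "f \<in> variety_Aut S"
  obtains g where "f \<in> extensional S" "regular_inverses S f g"
proof -
  have f: "f \<in> Bij S" "regular_map3 S f" "regular_map3 S (inv\<^bsub>BijGroup S\<^esub> f)"
    using assms by (simp_all add: variety_Aut_def carrier_BijGroup)
  have bij: "bij_betw f S S" using f(1) by (simp add: Bij_def)
  have "regular_inverses S f (inv\<^bsub>BijGroup S\<^esub> f)"
    using f bij by (auto simp: regular_inverses_def inv_BijGroup Bij_imp_funcset bij_betw_inv_into_left
      bij_betw_inv_into_right Bij_inv_into_mem bij_betwE)
  then show ?thesis using that Bij_imp_extensional[OF f(1)] by blast
qed

lemma polynomial_fun3_linear: "polynomial_fun3 (\<lambda>(x, y, z). a * x + b * y + c * z)"
  using add[OF add[OF mult[OF const[of a] coord_x] mult[OF const[of b] coord_y]] mult[OF const[of c] coord_z]]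
  by (simp add: case_prod_beta')

lemma regular_map3_linear:
  assumes "\<And>x y z. f (x, y, z) = (a1 * x + b1 * y + c1 * z, a2 * x + b2 * y + c2 * z, a3 * x + b3 * y + c3 * z)"
  shows "regular_map3 S (restrict f S)"
  unfolding regular_map3_def
  by (intro exI conjI) (rule polynomial_fun3_linear[of a1 b1 c1] polynomial_fun3_linear[of a2 b2 c2]
    polynomial_fun3_linear[of a3 b3 c3] | use assms in force)+

section \<open>Diagonal maps: group law, isomorphism type and action\<close>

lemma diag_map_comp: "diag_map n l s t (diag_map n l' s' t' p) = diag_map n (l * l') (s * s') (t * t') p"
  by (simp add: diag_map_def power_mult_distrib split: prod.split)

lemma diag_map_one [simp]: "diag_map n 1 1 1 = (\<lambda>p. p)"
  by (simp add: diag_map_def fun_eq_iff)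

text \<open>The equation is quasi-homogeneous of degree 2 (n - 1) when x, y, z have weights 2, n -
  2, n - 1, and y and z enter only through their squares.\<close>

lemma diag_map_surface:
  assumes "n \<ge> 2" "s \<in> {1, -1}" "t \<in> {1, -1}" "p \<in> klein_surface_D n"
  shows "diag_map n l s t p \<in> klein_surface_D n"
proof -
  obtain x y z where p: "p = (x, y, z)" by (cases p)
  define m where "m = n - 2"
  have m: "n - 1 = Suc m" "n - 2 = m" using assms(1) by (simp_all add: m_def)
  have st: "s\<^sup>2 = 1" "t\<^sup>2 = 1" using assms(2,3) by auto
  have "l\<^sup>2 * x * ((l\<^sup>2 * x) ^ m + (s * l ^ m * y)\<^sup>2) + (t * l ^ Suc m * z)\<^sup>2
      = (l ^ Suc m)\<^sup>2 * (x * (x ^ m + y\<^sup>2) + z\<^sup>2)"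
    by (simp add: power_mult_distrib st) (simp add: algebra_simps power2_eq_square power_mult_distrib)
  moreover have "x * (x ^ m + y\<^sup>2) + z\<^sup>2 = 0"
    using assms(1,4) by (simp add: p klein_surface_D_iff m_def)
  ultimately show ?thesis
    unfolding p diag_map_def prod.case klein_surface_D_iff[OF assms(1)] m by (simp only: mult_zero_right)
qed

lemma klein_GE:
  assumes "g \<in> klein_G n"
  obtains l s t where "l \<noteq> 0" "s \<in> {1, -1}" "t \<in> {1, -1}" "g = diag_map n l s t"
  using assms by (auto simp: klein_G_def)

lemma klein_GI: "l \<noteq> 0 \<Longrightarrow> s \<in> {1, -1} \<Longrightarrow> t \<in> {1, -1} \<Longrightarrow> diag_map n l s t \<in> klein_G n"
  unfolding klein_G_def by blast

lemma diag_map_inverse: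
  assumes "l \<noteq> 0" "s \<in> {1, -1}" "t \<in> {1, -1}"
  shows "diag_map n (inverse l) s t (diag_map n l s t p) = p" "diag_map n l s t (diag_map n (inverse l) s t p) = p"
  using assms by (auto simp: diag_map_comp)

lemma subgroup_klein_G: "subgroup (klein_G n) (BijGroup UNIV)"
proof (rule group.subgroupI[OF group_BijGroup])
  have Bij: "g \<in> Bij UNIV \<and> inv\<^bsub>BijGroup UNIV\<^esub> g \<in> klein_G n" if g: "g \<in> klein_G n" for g
  proof -
    obtain l s t where g: "l \<noteq> 0" "s \<in> {1, -1}" "t \<in> {1, -1}" "g = diag_map n l s t"
      using g by (rule klein_GE)
    show ?thesis
      using restrict_in_Bij[of "diag_map n l s t" UNIV "diag_map n (inverse l) s t"] diag_map_inverse[OF g(1-3)] g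
      by (simp add: klein_GI restrict_def)
  qed
  show "klein_G n \<subseteq> carrier (BijGroup UNIV)" using Bij by (auto simp: carrier_BijGroup)
  show "klein_G n \<noteq> {}" using klein_GI[of 1 1 1 n] by auto
  show "inv\<^bsub>BijGroup UNIV\<^esub> g \<in> klein_G n" if "g \<in> klein_G n" for g using Bij that by blast
  show "g \<otimes>\<^bsub>BijGroup UNIV\<^esub> h \<in> klein_G n" if gh: "g \<in> klein_G n" "h \<in> klein_G n" for g h
  proof -
    obtain l s t where g: "l \<noteq> 0" "s \<in> {1, -1}" "t \<in> {1, -1}" "g = diag_map n l s t"
      using gh(1) by (rule klein_GE)
    obtain l' s' t' where h: "l' \<noteq> 0" "s' \<in> {1, -1}" "t' \<in> {1, -1}" "h = diag_map n l' s' t'"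
      using gh(2) by (rule klein_GE)
    have "g \<otimes>\<^bsub>BijGroup UNIV\<^esub> h = diag_map n (l * l') (s * s') (t * t')"
      using Bij gh by (simp add: compose_def restrict_def fun_eq_iff) (simp add: g(4) h(4) diag_map_comp)
    then show ?thesis using g(1-3) h(1-3) by (auto intro!: klein_GI)
  qed
qed

lemma group_klein_G: "group (klein_G_group n)"
  unfolding klein_G_group_def by (rule subgroup.subgroup_is_group[OF subgroup_klein_G group_BijGroup])

lemma mult_klein_G_group:
  assumes "g \<in> klein_G n" "h \<in> klein_G n"
  shows "g \<otimes>\<^bsub>klein_G_group n\<^esub> h = (\<lambda>p. g (h p))"
proof -
  have "g \<in> Bij UNIV" "h \<in> Bij UNIV"
    using subgroup.subset[OF subgroup_klein_G[of n]] assms by (auto simp: carrier_BijGroup)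
  then show ?thesis by (simp add: klein_G_group_def compose_def restrict_def)
qed

lemma carrier_klein_G_group: "carrier (klein_G_group n) = klein_G n"
  by (simp add: klein_G_group_def)

lemma group_complex_mult_group: "group complex_mult_group"
  by (rule groupI) (auto simp: complex_mult_group_def intro!: bexI[of _ "inverse _"])

lemma diag_map_eq_iff:
  "diag_map n l s t = diag_map n l' s' t' \<longleftrightarrow>
     l\<^sup>2 = l'\<^sup>2 \<and> s * l ^ (n - 2) = s' * l' ^ (n - 2) \<and> t * l ^ (n - 1) = t' * l' ^ (n - 1)"
proof
  assume "diag_map n l s t = diag_map n l' s' t'"
  then have "diag_map n l s t (1, 1, 1) = diag_map n l' s' t' (1, 1, 1)" by simp
  then show "l\<^sup>2 = l'\<^sup>2 \<and> s * l ^ (n - 2) = s' * l' ^ (n - 2) \<and> t * l ^ (n - 1) = t' * l' ^ (n - 1)"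
    by (simp add: diag_map_def)
qed (auto simp: diag_map_def)

text \<open>Exactly one of \<open>n - 2\<close> and \<open>n - 1\<close> is odd, and the sign of that coordinate can be absorbed
  into \<open>l\<close>; the other sign is the factor \<open>\<int>/2\<int>\<close>.\<close>

lemma klein_G_iso:
  assumes n: "n \<ge> 2"
  shows "klein_G_group n \<cong> complex_mult_group \<times>\<times> integer_mod_group 2"
proof -
  let ?H = "complex_mult_group \<times>\<times> integer_mod_group 2"
  define \<sigma> :: "int \<Rightarrow> complex" where "\<sigma> e = (if e = 0 then 1 else - 1)" for e
  define \<psi> where "\<psi> q = (if even n then diag_map n (fst q) (\<sigma> (snd q)) 1 else diag_map n (fst q) 1 (\<sigma> (snd q)))" for q
  have carrier: "carrier ?H = (UNIV - {0}) \<times> {0, 1}"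
    by (auto simp: complex_mult_group_def carrier_integer_mod_group)
  have \<sigma>: "\<sigma> e \<in> {1, -1}" for e by (simp add: \<sigma>_def)
  have \<psi>G: "\<psi> q \<in> klein_G n" if "q \<in> carrier ?H" for q
    using that \<sigma> unfolding carrier \<psi>_def by (auto intro!: klein_GI)
  have "\<psi> \<in> hom ?H (klein_G_group n)"
  proof (rule homI)
    show "\<psi> q \<in> carrier (klein_G_group n)" if "q \<in> carrier ?H" for q
      using \<psi>G[OF that] by (simp add: carrier_klein_G_group)
    fix q r assume qr: "q \<in> carrier ?H" "r \<in> carrier ?H"
    have "snd q \<in> {0, 1}" "snd r \<in> {0, 1}" using qr unfolding carrier by auto
    then have "\<sigma> ((snd q + snd r) mod 2) = \<sigma> (snd q) * \<sigma> (snd r)" by (auto simp: \<sigma>_def)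
    then show "\<psi> (q \<otimes>\<^bsub>?H\<^esub> r) = \<psi> q \<otimes>\<^bsub>klein_G_group n\<^esub> \<psi> r"
      using \<psi>G[OF qr(1)] \<psi>G[OF qr(2)]
      by (simp add: mult_klein_G_group mult_DirProd') (simp add: \<psi>_def fun_eq_iff diag_map_comp complex_mult_group_def)
  qed
  moreover have "inj_on \<psi> (carrier ?H)"
  proof (rule inj_onI)
    fix q r assume qr: "q \<in> carrier ?H" "r \<in> carrier ?H" and eq: "\<psi> q = \<psi> r"
    obtain l e l' e' where q: "q = (l, e)" and r: "r = (l', e')" by (cases q, cases r) auto
    have nz: "l \<noteq> 0" "l' \<noteq> 0" and e: "e \<in> {0, 1}" "e' \<in> {0, 1}" using qr unfolding carrier q r by auto
    have inj\<sigma>: "\<sigma> e = \<sigma> e' \<Longrightarrow> e = e'" using e by (auto simp: \<sigma>_def)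
    have sq: "l\<^sup>2 = l'\<^sup>2" using eq by (auto simp: \<psi>_def q r diag_map_eq_iff split: if_splits)
    \<comment> \<open>The square of l fixes its even powers only; the coordinate without a sign
      carries an odd power and recovers l itself.\<close>
    have ev: "l ^ k = l' ^ k" if "even k" for k
      using that sq by (auto elim!: evenE simp: power_mult)
    show "q = r"
    proof (cases "even n")
      case True
      have "l ^ (n - 1) = l' ^ (n - 1)" "\<sigma> e * l ^ (n - 2) = \<sigma> e' * l' ^ (n - 2)"
        using eq True by (simp_all add: \<psi>_def q r diag_map_eq_iff)
      moreover have "n - 1 = Suc (n - 2)" using n by simp
      ultimately show ?thesis using ev[of "n - 2"] True nz inj\<sigma> by (simp add: q r)
    next
      case False
      have 1: "l ^ (n - 2) = l' ^ (n - 2)" "\<sigma> e * l ^ (n - 1) = \<sigma> e' * l' ^ (n - 1)"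
        using eq False by (simp_all add: \<psi>_def q r diag_map_eq_iff)
      have "n - 1 = Suc (n - 2)" using n by simp
      then have "l = l'" using ev[of "n - 1"] 1(1) False nz by simp
      then show ?thesis using 1(2) nz inj\<sigma> by (simp add: q r)
    qed
  qed
  moreover have "\<psi> ` carrier ?H = klein_G n"
  proof
    show "\<psi> ` carrier ?H \<subseteq> klein_G n" using \<psi>G by blast
    show "klein_G n \<subseteq> \<psi> ` carrier ?H"
    proof
      fix g assume "g \<in> klein_G n"
      then obtain l s t where g: "l \<noteq> 0" "s \<in> {1, -1}" "t \<in> {1, -1}" "g = diag_map n l s t"
        by (rule klein_GE)
      have ex: "\<exists>e\<in>{0, 1}. \<sigma> e = s" if "s \<in> {1, -1}" for s
        using that by (auto simp: \<sigma>_def)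
      have pw: "s ^ k = (if even k then 1 else s)" if "s \<in> {1, -1}" for s :: complex and k
        using that by auto
      have n12: "even (n - 2) \<longleftrightarrow> even n" "even (n - 1) \<longleftrightarrow> odd n" using n by auto
      show "g \<in> \<psi> ` carrier ?H"
      proof (cases "even n")
        case True
        obtain e where e: "e \<in> {0, 1}" "\<sigma> e = s" using ex[OF g(2)] by blast
        \<comment> \<open>Passing from l to t l changes neither l^2 nor the even power l^(n - 2) and
          multiplies the odd power l^(n - 1) by t.\<close>
        have "g = \<psi> (t * l, e)"
          using True g(3) n12 by (auto simp: \<psi>_def e(2) g(4) diag_map_eq_iff power_mult_distrib pw)
        then show ?thesis using e(1) g(1,3) unfolding carrier by (intro image_eqI) auto
      next
        case False
        obtain e where e: "e \<in> {0, 1}" "\<sigma> e = t" using ex[OF g(3)] by blast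
        have "g = \<psi> (s * l, e)"
          using False g(2) n12 by (auto simp: \<psi>_def e(2) g(4) diag_map_eq_iff power_mult_distrib pw)
        then show ?thesis using e(1) g(1,2) unfolding carrier by (intro image_eqI) auto
      qed
    qed
  qed
  ultimately have "\<psi> \<in> iso ?H (klein_G_group n)"
    by (simp add: iso_def bij_betw_def carrier_klein_G_group)
  then have "?H \<cong> klein_G_group n" unfolding is_iso_def by blast
  moreover have "group ?H" using group_complex_mult_group by (intro DirProd_group) simp_all
  ultimately show ?thesis using group.iso_sym by blast
qed

lemma regular_inverses_diag:
  assumes "n \<ge> 2" "l \<noteq> 0" "s \<in> {1, -1}" "t \<in> {1, -1}"
  shows "regular_inverses (klein_surface_D n)
    (restrict (diag_map n l s t) (klein_surface_D n)) (restrict (diag_map n (inverse l) s t) (klein_surface_D n))"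
proof -
  have reg: "regular_map3 S (restrict (diag_map n l s t) S)" for l S
    by (rule regular_map3_linear[of _ "l\<^sup>2" 0 0 0 "s * l ^ (n - 2)" 0 0 0 "t * l ^ (n - 1)"])
      (simp add: diag_map_def)
  show ?thesis
    using assms diag_map_inverse[OF assms(2-4), of n]
    by (auto simp: regular_inverses_def reg diag_map_surface)
qed

lemma restrict_diag_in_Bij:
  assumes "n \<ge> 2" "g \<in> klein_G n"
  shows "restrict g (klein_surface_D n) \<in> Bij (klein_surface_D n)"
    and "restrict g (klein_surface_D n) \<in> variety_Aut (klein_surface_D n)"
    and "g \<in> klein_surface_D n \<rightarrow> klein_surface_D n"
proof -
  obtain l s t where g: "l \<noteq> 0" "s \<in> {1, -1}" "t \<in> {1, -1}" "g = diag_map n l s t"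
    using assms(2) by (rule klein_GE)
  show aut: "restrict g (klein_surface_D n) \<in> variety_Aut (klein_surface_D n)"
    using variety_AutI[OF regular_inverses_diag[OF assms(1) g(1-3)]] by (simp add: g(4))
  then show "restrict g (klein_surface_D n) \<in> Bij (klein_surface_D n)"
    by (simp add: variety_Aut_def carrier_BijGroup)
  show "g \<in> klein_surface_D n \<rightarrow> klein_surface_D n"
    using diag_map_surface[OF assms(1) g(2,3)] by (auto simp: g(4))
qed

lemma group_hom_klein_G:
  assumes "n \<ge> 2"
  shows "group_hom (klein_G_group n) (BijGroup (klein_surface_D n)) (\<lambda>g. restrict g (klein_surface_D n))"
proof (intro group_hom.intro group_hom_axioms.intro homI)
  show "group (klein_G_group n)" "group (BijGroup (klein_surface_D n))"
    by (rule group_klein_G, rule group_BijGroup)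
  show "restrict g (klein_surface_D n) \<in> carrier (BijGroup (klein_surface_D n))" if "g \<in> carrier (klein_G_group n)" for g
    using that restrict_diag_in_Bij(1)[OF assms] by (simp add: carrier_klein_G_group carrier_BijGroup)
  show "restrict (g \<otimes>\<^bsub>klein_G_group n\<^esub> h) (klein_surface_D n) =
      restrict g (klein_surface_D n) \<otimes>\<^bsub>BijGroup (klein_surface_D n)\<^esub> restrict h (klein_surface_D n)"
    if "g \<in> carrier (klein_G_group n)" "h \<in> carrier (klein_G_group n)" for g h
    using that restrict_diag_in_Bij(1,3)[OF assms]
    by (auto simp: carrier_klein_G_group mult_klein_G_group compose_def fun_eq_iff)
qed

lemma faithful_action_klein_G:
  assumes "n \<ge> 2"
  shows "faithful_action (klein_G_group n) (klein_surface_D n) (\<lambda>g. restrict g (klein_surface_D n))"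
proof (intro faithful_action.intro group_action.intro faithful_action_axioms.intro inj_onI)
  show "group_hom (klein_G_group n) (BijGroup (klein_surface_D n)) (\<lambda>g. restrict g (klein_surface_D n))"
    by (rule group_hom_klein_G[OF assms])
  fix g h assume gh: "g \<in> carrier (klein_G_group n)" "h \<in> carrier (klein_G_group n)"
    and eq: "restrict g (klein_surface_D n) = restrict h (klein_surface_D n)"
  obtain l s t where g: "g = diag_map n l s t"
    using gh(1) unfolding carrier_klein_G_group by (rule klein_GE)
  obtain l' s' t' where h: "h = diag_map n l' s' t'"
    using gh(2) unfolding carrier_klein_G_group by (rule klein_GE)
  \<comment> \<open>The point (1, 1, r) of the surface has no zero coordinate, so its image reveals
    all three factors of a diagonal map.\<close>
  obtain r :: complex where r: "r\<^sup>2 = - 2" by (metis power2_csqrt)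
  then have "(1, 1, r) \<in> klein_surface_D n" by (simp add: klein_surface_D_def)
  then have "g (1, 1, r) = h (1, 1, r)" using eq by (metis restrict_apply')
  moreover have "r \<noteq> 0" using r by auto
  ultimately show "g = h" unfolding g h by (subst diag_map_eq_iff) (simp add: diag_map_def)
qed

lemma subgroup_klein_G_on:
  assumes "n \<ge> 2"
  shows "subgroup (klein_G_on n) (variety_Aut_group (klein_surface_D n))"
proof -
  have "subgroup ((\<lambda>g. restrict g (klein_surface_D n)) ` carrier (klein_G_group n)) (BijGroup (klein_surface_D n))"
    by (rule group_hom.img_is_subgroup[OF group_hom_klein_G[OF assms]])
  then have "subgroup (klein_G_on n) (BijGroup (klein_surface_D n))"
    by (simp add: klein_G_on_def carrier_klein_G_group)
  moreover have "klein_G_on n \<subseteq> variety_Aut (klein_surface_D n)"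
    using restrict_diag_in_Bij(2)[OF assms] by (auto simp: klein_G_on_def)
  ultimately show ?thesis
    unfolding variety_Aut_group_def using group.subgroup_incl[OF group_BijGroup _ subgroup_variety_Aut] by blast
qed

section \<open>The case n = 4 and the main theorem\<close>

lemma variety_Aut_subset_klein_G_on:
  assumes n: "n \<ge> 5"
  shows "variety_Aut (klein_surface_D n) \<subseteq> klein_G_on n"
proof
  let ?S = "klein_surface_D n"
  fix f assume "f \<in> variety_Aut ?S"
  then obtain g where f: "f \<in> extensional ?S" "regular_inverses ?S f g" by (rule variety_AutE)
  then obtain h where h: "h \<in> klein_G n" "\<And>p. p \<in> ?S \<Longrightarrow> f p = h p"
    using automorphism_cases[of n f g] n by auto
  have "f = restrict h ?S"
    by (rule extensionalityI[OF f(1)]) (simp_all add: h(2))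
  then show "f \<in> klein_G_on n" unfolding klein_G_on_def using h(1) by blast
qed

text \<open>The square and inverse of \<open>tau\<close>, obtained from it by replacing \<i> with -
  \<i>.\<close>

definition tau2 :: "point3 \<Rightarrow> point3" where
  "tau2 = (\<lambda>(x, y, z). (- (1 / 2) * x - \<i> / 2 * y, - (3 / 2) * \<i> * x - 1 / 2 * y, z))"

lemma tau_comp:
  "tau (tau p) = tau2 p" "tau (tau2 p) = p" "tau2 (tau p) = p" "tau2 (tau2 p) = tau p"
  by (cases p; simp add: tau_def tau2_def algebra_simps add_divide_distrib diff_divide_distrib)+

text \<open>The cubic x^3 + x y^2 is the product of x, x + \<i> y and x - \<i> y. These forms are
  permuted cyclically up to the factors - 2, 1 and - 1/2, whose product is 1; the sign e treats
  \<open>tau\<close> and its inverse together.\<close>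

lemma tau_surface:
  assumes "p \<in> klein_surface_D 4"
  shows "tau p \<in> klein_surface_D 4" "tau2 p \<in> klein_surface_D 4"
proof -
  obtain x y z where p: "p = (x, y, z)" by (cases p)
  have cubic: "x' ^ 3 + x' * y'\<^sup>2 = x ^ 3 + x * y\<^sup>2"
    if "x' = - (1 / 2) * x + e * \<i> / 2 * y" "y' = e * (3 / 2) * \<i> * x - 1 / 2 * y" "e * e = 1" for x' y' e
  proof -
    have "x' + \<i> * e * y' = - 2 * x + (1 - e * e) * x * (3 / 2)"
      unfolding that(1,2) by (simp add: algebra_simps)
    then have 1: "x' + \<i> * e * y' = - 2 * x" using that(3) by simp
    have 2: "x' - \<i> * e * y' = x + \<i> * e * y"
      unfolding that(1,2) using that(3) by (simp add: algebra_simps)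
    have 3: "x' = - (1 / 2) * (x - \<i> * e * y)" unfolding that(1) by (simp add: algebra_simps)
    have factor: "a ^ 3 + a * b\<^sup>2 = a * ((a + \<i> * e * b) * (a - \<i> * e * b))" for a b
    proof -
      have "a * ((a + \<i> * e * b) * (a - \<i> * e * b)) = a ^ 3 + (e * e) * (a * b\<^sup>2)"
        by (simp add: algebra_simps power2_eq_square power3_eq_cube)
      then show ?thesis using that(3) by simp
    qed
    show ?thesis unfolding factor 1 2 by (subst 3) (simp add: algebra_simps)
  qed
  have "x ^ 3 + x * y\<^sup>2 + z\<^sup>2 = 0" using assms by (simp add: p klein_surface_D_def)
  then show "tau p \<in> klein_surface_D 4" "tau2 p \<in> klein_surface_D 4"
    using cubic[OF refl refl, of 1] cubic[OF refl refl, of "- 1"]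
    by (simp_all add: p klein_surface_D_def tau_def tau2_def)
qed

text \<open>For n = 4 a diagonal map acts on (x, y) as a scalar times diag(1, s). Scalars commute
  with \<open>tau\<close>, and the reflection for s = - 1 conjugates it to its inverse.\<close>

lemma diag_map_tau:
  assumes "s \<in> {1, -1}"
  shows "diag_map 4 l s t (tau p) = (if s = 1 then tau else tau2) (diag_map 4 l s t p)"
    and "diag_map 4 l s t (tau2 p) = (if s = 1 then tau2 else tau) (diag_map 4 l s t p)"
proof -
  obtain x y z where p: "p = (x, y, z)" by (cases p)
  define m where "m = l\<^sup>2"
  have s: "s = 1 \<or> s = - 1" using assms by simp
  show "diag_map 4 l s t (tau p) = (if s = 1 then tau else tau2) (diag_map 4 l s t p)"
    using s by (elim disjE; simp add: p diag_map_def tau_def tau2_def flip: m_def) (simp_all add: algebra_simps)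
  show "diag_map 4 l s t (tau2 p) = (if s = 1 then tau2 else tau) (diag_map 4 l s t p)"
    using s by (elim disjE; simp add: p diag_map_def tau_def tau2_def flip: m_def) (simp_all add: algebra_simps)
qed

lemma regular_inverses_tau:
  "regular_inverses (klein_surface_D 4) (restrict tau (klein_surface_D 4)) (restrict tau2 (klein_surface_D 4))"
proof -
  have "regular_map3 S (restrict tau S)" for S
    by (rule regular_map3_linear[of _ "- (1 / 2)" "\<i> / 2" 0 "3 / 2 * \<i>" "- (1 / 2)" 0 0 0 1]) (simp add: tau_def)
  moreover have "regular_map3 S (restrict tau2 S)" for S
    by (rule regular_map3_linear[of _ "- (1 / 2)" "- \<i> / 2" 0 "- (3 / 2) * \<i>" "- (1 / 2)" 0 0 0 1]) (simp add: tau2_def)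
  ultimately show ?thesis by (auto simp: regular_inverses_def tau_surface tau_comp)
qed

lemma regular_inverses_sym: "regular_inverses S f g \<Longrightarrow> regular_inverses S g f"
  by (simp add: regular_inverses_def)

text \<open>In the exceptional alternative, comparing both formulas at (0, 1, 0) forces k' = 0, so
  every image would have x = 0, although f is onto.\<close>

lemma diagonal_if_scales_fst:
  assumes f: "regular_inverses (klein_surface_D 4) f g"
    and k: "\<And>p. p \<in> klein_surface_D 4 \<Longrightarrow> fst (f p) = k * fst p"
  shows "\<exists>h\<in>klein_G 4. \<forall>p\<in>klein_surface_D 4. f p = h p"
proof (rule ccontr)
  assume "\<not> ?thesis"
  then obtain k' e where e: "e \<in> {1, -1}"
    "\<And>p. p \<in> klein_surface_D 4 \<Longrightarrow> fst (f p) = k' * (fst p + e * \<i> * fst (snd p))"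
    using automorphism_cases[OF _ f] by blast
  have p: "(-1, 0, 1) \<in> klein_surface_D 4" "(0, 1, 0) \<in> klein_surface_D 4"
    by (simp_all add: klein_surface_D_def)
  have "k' = 0" using k[OF p(2)] e(2)[OF p(2)] e(1) by auto
  then have fst0: "fst (f q) = 0" if "q \<in> klein_surface_D 4" for q using e(2)[OF that] by simp
  have "g (-1, 0, 1) \<in> klein_surface_D 4" "f (g (-1, 0, 1)) = (-1, 0, 1)"
    using f p(1) unfolding regular_inverses_def by blast+
  with fst0[OF this(1)] show False by simp
qed

text \<open>In the exceptional case f after \<open>tau\<close> or its inverse scales the first
  coordinate and is therefore diagonal. Solving for f leaves a power of \<open>tau\<close> on the
  right, which is then moved across the diagonal map.\<close>

lemma automorphism_decomposition:
  assumes f: "regular_inverses (klein_surface_D 4) f g"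
  shows "\<exists>h\<in>{\<lambda>p. p, tau, tau2}. \<exists>g\<in>klein_G 4. \<forall>p\<in>klein_surface_D 4. f p = h (g p)"
proof -
  let ?S = "klein_surface_D 4"
  have twisted: ?thesis
    if h: "h = tau \<and> h' = tau2 \<or> h = tau2 \<and> h' = tau"
      and k: "\<And>p. p \<in> ?S \<Longrightarrow> fst (f (h p)) = k * fst p" for h h' k
  proof -
    have hS: "h p \<in> ?S" "h' p \<in> ?S" "h (h' p) = p" if "p \<in> ?S" for p
      using that h by (auto simp: tau_surface tau_comp)
    have "regular_inverses ?S (restrict h ?S) (restrict h' ?S)"
      using h regular_inverses_tau regular_inverses_sym by auto
    from diagonal_if_scales_fst[OF regular_inverses_compose[OF f this], of k]
    obtain d where d: "d \<in> klein_G 4" "\<And>p. p \<in> ?S \<Longrightarrow> f (h p) = d p"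
      using k by (auto simp: compose_eq)
    obtain l s t where l: "s \<in> {1, -1}" "d = diag_map 4 l s t" using d(1) by (rule klein_GE)
    \<comment> \<open>A diagonal map with s = - 1 inverts the power of \<open>tau\<close> that
      passes through it.\<close>
    define h'' where "h'' = (if s = 1 then h' else h)"
    have "f p = h'' (d p)" if "p \<in> ?S" for p
    proof -
      have "f p = d (h' p)" using d(2)[OF hS(2)[OF that]] hS(3)[OF that] by simp
      then show ?thesis using h diag_map_tau[OF l(1), of l t p] by (auto simp: h''_def l(2))
    qed
    moreover have "h'' \<in> {\<lambda>p. p, tau, tau2}" using h by (auto simp: h''_def)
    ultimately show ?thesis
      using d(1) by (intro bexI[of _ h''] bexI[of _ d] ballI) simp_all
  qed
  consider (diag) "\<exists>g\<in>klein_G 4. \<forall>p\<in>?S. f p = g p"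
    | (twist) k e where "e \<in> {1, -1}" "\<forall>p\<in>?S. fst (f p) = k * (fst p + e * \<i> * fst (snd p))"
    using automorphism_cases[OF _ f] by blast
  then show ?thesis
  proof cases
    case diag
    then show ?thesis by simp
  next
    case (twist k e)
    from twist(1) consider "e = 1" | "e = - 1" by blast
    then show ?thesis
    proof cases
      case 1
      have "fst (tau p) + \<i> * fst (snd (tau p)) = - 2 * fst p" for p
        by (cases p) (simp add: tau_def algebra_simps)
      then have "fst (f (tau p)) = (k * - 2) * fst p" if "p \<in> ?S" for p
        using twist(2) tau_surface(1)[OF that] 1 by simp
      then show ?thesis by (rule twisted[where h' = tau2, rotated]) simp_all
    next
      case 2
      have "fst (tau2 p) - \<i> * fst (snd (tau2 p)) = - 2 * fst p" for p
        by (cases p) (simp add: tau2_def algebra_simps)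
      then have "fst (f (tau2 p)) = (k * - 2) * fst p" if "p \<in> ?S" for p
        using twist(2) tau_surface(2)[OF that] 2 by simp
      then show ?thesis by (rule twisted[where h' = tau, rotated]) simp_all
    qed
  qed
qed

section \<open>The semidirect product for n = 4\<close>

lemma mult_variety_Aut_group:
  "f \<in> variety_Aut S \<Longrightarrow> g \<in> variety_Aut S \<Longrightarrow> f \<otimes>\<^bsub>variety_Aut_group S\<^esub> g = compose S f g"
  by (simp add: variety_Aut_group_def variety_Aut_def carrier_BijGroup)

lemma carrier_variety_Aut_group: "carrier (variety_Aut_group S) = variety_Aut S"
  by (simp add: variety_Aut_group_def)

lemma one_variety_Aut_group: "\<one>\<^bsub>variety_Aut_group S\<^esub> = (\<lambda>x\<in>S. x)"
  by (simp add: variety_Aut_group_def one_BijGroup)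

lemma tau_semidirect:
  defines "K \<equiv> variety_Aut_group (klein_surface_D 4)"
  shows "tau_on \<in> carrier K" "group.ord K tau_on = 3"
    "internal_semidirect K (generate K {tau_on}) (klein_G_on 4)"
proof -
  let ?S = "klein_surface_D 4"
  define t2 where "t2 = restrict tau2 ?S"
  interpret K: group K unfolding K_def by (rule group_variety_Aut_group)
  have carrier: "carrier K = variety_Aut ?S" by (simp add: K_def carrier_variety_Aut_group)
  have mult: "f \<otimes>\<^bsub>K\<^esub> g = compose ?S f g" if "f \<in> carrier K" "g \<in> carrier K" for f g
    using that by (simp add: K_def carrier_variety_Aut_group mult_variety_Aut_group)
  have one: "\<one>\<^bsub>K\<^esub> = (\<lambda>x\<in>?S. x)" by (simp add: K_def one_variety_Aut_group)
  show t: "tau_on \<in> carrier K"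
    using variety_AutI[OF regular_inverses_tau] by (simp add: carrier tau_on_def)
  have t2: "t2 \<in> carrier K"
    using variety_AutI[OF regular_inverses_sym[OF regular_inverses_tau]] by (simp add: carrier t2_def)
  have tt: "tau_on \<otimes>\<^bsub>K\<^esub> tau_on = t2" "tau_on \<otimes>\<^bsub>K\<^esub> t2 = \<one>\<^bsub>K\<^esub>" "t2 \<otimes>\<^bsub>K\<^esub> tau_on = \<one>\<^bsub>K\<^esub>" "t2 \<otimes>\<^bsub>K\<^esub> t2 = tau_on"
    using t t2 by (simp_all add: mult one) (auto simp: tau_on_def t2_def compose_def fun_eq_iff tau_surface tau_comp)
  \<comment> \<open>At this point y = 0. Diagonal maps preserve that, the nontrivial powers of
    \<open>tau\<close> do not, so the two subgroups meet trivially.\<close>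
  have p: "(-1, 0, 1) \<in> ?S" by (simp add: klein_surface_D_def)
  have tp: "fst (snd (tau_on (-1, 0, 1))) \<noteq> 0" "fst (snd (t2 (-1, 0, 1))) \<noteq> 0"
    using p by (simp_all add: tau_on_def t2_def tau_def tau2_def)
  have Gp: "fst (snd (g (-1, 0, 1))) = 0" if gG: "g \<in> klein_G_on 4" for g
  proof -
    obtain l s t where "g = restrict (diag_map 4 l s t) ?S"
      using gG unfolding klein_G_on_def klein_G_def by blast
    then show ?thesis using p by (simp add: diag_map_def)
  qed
  have not_G: "tau_on \<notin> klein_G_on 4" "t2 \<notin> klein_G_on 4"
    using tp Gp by blast+
  have subG: "subgroup (klein_G_on 4) K" unfolding K_def by (rule subgroup_klein_G_on) simp
  then have "tau_on \<noteq> \<one>\<^bsub>K\<^esub>" using not_G(1) subgroup.one_closed[OF subG] by auto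
  have "tau_on [^]\<^bsub>K\<^esub> (3 :: nat) = \<one>\<^bsub>K\<^esub>"
    using t tt by (simp add: numeral_3_eq_3)
  then have "K.ord tau_on dvd 3" using K.pow_eq_id[OF t] by blast
  moreover have "K.ord tau_on \<noteq> 1" using K.ord_eq_1[OF t] \<open>tau_on \<noteq> _\<close> by simp
  moreover have "Factorial_Ring.prime (3 :: nat)" by simp
  ultimately show "K.ord tau_on = 3" using prime_nat_iff by blast
  define H where "H = {\<one>\<^bsub>K\<^esub>, tau_on, t2}"
  have inv: "inv\<^bsub>K\<^esub> tau_on = t2" "inv\<^bsub>K\<^esub> t2 = tau_on"
    using K.inv_equality t t2 tt by blast+
  have subH: "subgroup H K"
    by (rule K.subgroupI) (use t t2 tt inv in \<open>auto simp: H_def\<close>)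
  have H: "generate K {tau_on} = H"
  proof
    show "generate K {tau_on} \<subseteq> H" by (rule K.generate_subgroup_incl[OF _ subH]) (simp add: H_def)
    have "tau_on \<in> generate K {tau_on}" by (rule generate.incl) simp
    moreover from this have "t2 \<in> generate K {tau_on}" using generate.eng tt(1) by metis
    ultimately show "H \<subseteq> generate K {tau_on}" using generate.one by (auto simp: H_def)
  qed
  have G_carrier: "g \<in> carrier K" if "g \<in> klein_G_on 4" for g using subgroup.subset[OF subG] that by blast
  have decomp: "\<exists>m\<in>H. \<exists>g\<in>klein_G_on 4. f = m \<otimes>\<^bsub>K\<^esub> g" if f: "f \<in> carrier K" for f
  proof -
    obtain f' where ext: "f \<in> extensional ?S" "regular_inverses ?S f f'"
      using f unfolding carrier by (rule variety_AutE)
    obtain h d where h: "h \<in> {\<lambda>p. p, tau, tau2}" and d: "d \<in> klein_G 4"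
      and eq: "\<And>p. p \<in> ?S \<Longrightarrow> f p = h (d p)"
      using automorphism_decomposition[OF ext(2)] by blast
    have hH: "restrict h ?S \<in> H" using h by (auto simp: H_def one tau_on_def t2_def)
    have g: "restrict d ?S \<in> klein_G_on 4" unfolding klein_G_on_def using d by blast
    have dS: "d \<in> ?S \<rightarrow> ?S" by (rule restrict_diag_in_Bij(3)[OF _ d]) simp
    have "f = compose ?S (restrict h ?S) (restrict d ?S)"
      by (rule extensionalityI[OF ext(1)]) (use dS in \<open>auto simp: compose_eq eq Pi_iff\<close>)
    also have "\<dots> = restrict h ?S \<otimes>\<^bsub>K\<^esub> restrict d ?S"
      using mult hH g G_carrier subgroup.subset[OF subH] by auto
    finally have "f = restrict h ?S \<otimes>\<^bsub>K\<^esub> restrict d ?S" .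
    then show ?thesis using hH g by blast
  qed
  have comm: "\<exists>h'\<in>H. g \<otimes>\<^bsub>K\<^esub> h = h' \<otimes>\<^bsub>K\<^esub> g" if g: "g \<in> klein_G_on 4" and h: "h \<in> H" for g h
  proof -
    have gK: "g \<in> carrier K" by (rule G_carrier[OF g])
    obtain l s t where l: "s \<in> {1, -1}" "t \<in> {1, -1}" "g = restrict (diag_map 4 l s t) ?S"
      using g unfolding klein_G_on_def klein_G_def by blast
    have dS: "diag_map 4 l s t p \<in> ?S" if "p \<in> ?S" for p
      using diag_map_surface[of 4 s t p l] l that by simp
    have swap: "g \<otimes>\<^bsub>K\<^esub> restrict h ?S = restrict h' ?S \<otimes>\<^bsub>K\<^esub> g"
      if "restrict h ?S \<in> carrier K" "restrict h' ?S \<in> carrier K" "\<And>p. p \<in> ?S \<Longrightarrow> h p \<in> ?S"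
        "\<And>p. diag_map 4 l s t (h p) = h' (diag_map 4 l s t p)" for h h'
    proof -
      have "compose ?S g (restrict h ?S) = compose ?S (restrict h' ?S) g"
        by (rule ext) (simp add: l(3) compose_def that(3,4) dS)
      then show ?thesis using gK that(1,2) by (simp add: mult)
    qed
    have "g \<otimes>\<^bsub>K\<^esub> tau_on = (if s = 1 then tau_on else t2) \<otimes>\<^bsub>K\<^esub> g"
      "g \<otimes>\<^bsub>K\<^esub> t2 = (if s = 1 then t2 else tau_on) \<otimes>\<^bsub>K\<^esub> g"
      using swap[of tau "if s = 1 then tau else tau2", OF _ _ tau_surface(1) diag_map_tau(1)[OF l(1)]]
        swap[of tau2 "if s = 1 then tau2 else tau", OF _ _ tau_surface(2) diag_map_tau(2)[OF l(1)]] t t2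
      by (simp_all add: tau_on_def t2_def split: if_splits)
    moreover have "g \<otimes>\<^bsub>K\<^esub> \<one>\<^bsub>K\<^esub> = \<one>\<^bsub>K\<^esub> \<otimes>\<^bsub>K\<^esub> g" using gK by simp
    moreover have "(if s = 1 then tau_on else t2) \<in> H" "(if s = 1 then t2 else tau_on) \<in> H" "\<one>\<^bsub>K\<^esub> \<in> H"
      by (simp_all add: H_def)
    ultimately show ?thesis using h unfolding H_def by blast
  qed
  have HK: "h \<in> carrier K" if "h \<in> H" for h using subgroup.subset[OF subH] that by blast
  \<comment> \<open>Writing x = m g reduces normality to two conjugations: by g it stays in H
    because of \<open>comm\<close>, by m because H is a subgroup.\<close>
  have "x \<otimes>\<^bsub>K\<^esub> h \<otimes>\<^bsub>K\<^esub> inv\<^bsub>K\<^esub> x \<in> H" if x: "x \<in> carrier K" and h: "h \<in> H" for x h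
  proof -
    obtain m g where m: "m \<in> H" "g \<in> klein_G_on 4" "x = m \<otimes>\<^bsub>K\<^esub> g" using decomp[OF x] by blast
    obtain h' where h': "h' \<in> H" "g \<otimes>\<^bsub>K\<^esub> h = h' \<otimes>\<^bsub>K\<^esub> g" using comm[OF m(2) h] by blast
    note c = HK[OF m(1)] G_carrier[OF m(2)] HK[OF h] HK[OF h'(1)]
    have "x \<otimes>\<^bsub>K\<^esub> h = m \<otimes>\<^bsub>K\<^esub> h' \<otimes>\<^bsub>K\<^esub> g" using c h'(2) by (simp add: m(3) K.m_assoc)
    also have "\<dots> = (m \<otimes>\<^bsub>K\<^esub> h' \<otimes>\<^bsub>K\<^esub> inv\<^bsub>K\<^esub> m) \<otimes>\<^bsub>K\<^esub> x"
      using c by (simp add: m(3) K.m_assoc) (simp flip: K.m_assoc)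
    finally have "x \<otimes>\<^bsub>K\<^esub> h \<otimes>\<^bsub>K\<^esub> inv\<^bsub>K\<^esub> x = m \<otimes>\<^bsub>K\<^esub> h' \<otimes>\<^bsub>K\<^esub> inv\<^bsub>K\<^esub> m"
      using c x by (simp add: K.m_assoc)
    also have "\<dots> \<in> H" using subH m(1) h'(1) by (simp add: subgroup.m_closed subgroup.m_inv_closed)
    finally show ?thesis .
  qed
  then have "H \<lhd> K" using subH K.normal_inv_iff by blast
  moreover have "H \<inter> klein_G_on 4 = {\<one>\<^bsub>K\<^esub>}"
    using not_G subgroup.one_closed[OF subG] by (auto simp: H_def)
  moreover have "H <#>\<^bsub>K\<^esub> klein_G_on 4 = carrier K"
    using decomp HK G_carrier by (auto simp: set_mult_def)
  ultimately show "internal_semidirect K (generate K {tau_on}) (klein_G_on 4)"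
    using subG by (simp add: internal_semidirect_def H)
qed

theorem corollary4p5:
  fixes n :: nat
  assumes "n \<ge> 4"
  shows "subgroup (klein_G n) (BijGroup UNIV)
    \<and> klein_G_group n \<cong> complex_mult_group \<times>\<times> integer_mod_group 2
    \<and> faithful_action (klein_G_group n) (klein_surface_D n) (\<lambda>g. restrict g (klein_surface_D n))
    \<and> klein_G_on n \<subseteq> carrier (variety_Aut_group (klein_surface_D n))
    \<and> (n \<ge> 5 \<longrightarrow> carrier (variety_Aut_group (klein_surface_D n)) = klein_G_on n)
    \<and> (n = 4 \<longrightarrow>
         tau_on \<in> carrier (variety_Aut_group (klein_surface_D n))
         \<and> group.ord (variety_Aut_group (klein_surface_D n)) tau_on = 3
         \<and> internal_semidirect (variety_Aut_group (klein_surface_D n))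
              (generate (variety_Aut_group (klein_surface_D n)) {tau_on}) (klein_G_on n))"
proof -
  have n: "n \<ge> 2" using assms by simp
  have sub: "klein_G_on n \<subseteq> carrier (variety_Aut_group (klein_surface_D n))"
    by (rule subgroup.subset[OF subgroup_klein_G_on[OF n]])
  then have "carrier (variety_Aut_group (klein_surface_D n)) = klein_G_on n" if "n \<ge> 5"
    using variety_Aut_subset_klein_G_on[OF that] by (auto simp: carrier_variety_Aut_group)
  then show ?thesis
    using subgroup_klein_G klein_G_iso[OF n] faithful_action_klein_G[OF n] sub tau_semidirect by auto
qed

end
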